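(* For each positive integer $n$, let $a_n$ denote the number of unlabelled $n$-vertex word-representable graphs, i.e. the number of isomorphism classes of word-representable graphs on $n$ vertices. Then, as $n\to\infty$, $$a_n=2^{\frac{n^2}{3}+o(n^2)}.$$
   Context: Graphs are finite and simple. Distinct letters $x$ and $y$ alternate in a word $w$ if deleting all other letters from $w$ results in a word of the form $xyxy\cdots$ or $yxyx\cdots$ (of even or odd length). A graph $G=(V,E)$ is word-representable if there exists a finite word $w$ over the alphabet $V$, in which each letter of $V$ occurs at least once, such that for all distinct $x,y\in V$, the letters $x$ and $y$ alternate in $w$ if and only if $\{x,y\}\in E$. *)

theory Defs
  imports Complex_Main "HOL-Library.Landau_Symbols"
begin

type_synonym 'a graph = "'a set \<times> 'a set set"

definition simple_graph :: "'a graph \<Rightarrow> bool" where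
  "simple_graph G \<longleftrightarrow>
     (case G of (V, E) \<Rightarrow> finite V \<and> E \<subseteq> {e. e \<subseteq> V \<and> card e = 2})"

definition graph_iso :: "'a graph \<Rightarrow> 'b graph \<Rightarrow> bool" where
  "graph_iso G H \<longleftrightarrow>
     (case (G, H) of ((V, E), (V', E')) \<Rightarrow>
        \<exists>f. bij_betw f V V' \<and> (\<forall>x\<in>V. \<forall>y\<in>V. {x, y} \<in> E \<longleftrightarrow> {f x, f y} \<in> E'))"

(* The word xyxy... of length k. *)
definition alternating_word :: "'a \<Rightarrow> 'a \<Rightarrow> nat \<Rightarrow> 'a list" where
  "alternating_word x y k = map (\<lambda>i. if even i then x else y) [0..<k]"

definition alternate :: "'a \<Rightarrow> 'a \<Rightarrow> 'a list \<Rightarrow> bool" where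
  "alternate x y w \<longleftrightarrow>
     (\<exists>k. filter (\<lambda>z. z = x \<or> z = y) w = alternating_word x y k \<or>
          filter (\<lambda>z. z = x \<or> z = y) w = alternating_word y x k)"

definition word_representable :: "'a graph \<Rightarrow> bool" where
  "word_representable G \<longleftrightarrow>
     (case G of (V, E) \<Rightarrow>
        \<exists>w. set w = V \<and> (\<forall>x\<in>V. \<forall>y\<in>V. x \<noteq> y \<longrightarrow> (alternate x y w \<longleftrightarrow> {x, y} \<in> E)))"

definition word_representable_graphs :: "nat \<Rightarrow> nat graph set" where
  "word_representable_graphs n =
     {(V, E). V = {1..n} \<and> simple_graph (V, E) \<and> word_representable (V, E)}"

definition graph_iso_on :: "'a graph set \<Rightarrow> 'a graph rel" where
  "graph_iso_on S = {(G, H). G \<in> S \<and> H \<in> S \<and> graph_iso G H}"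

(* Isomorphism classes are counted on the vertex set {1..n}; every n-vertex graph has an
   isomorphic copy there, see ex_iso_word_representable_graphs below. *)
definition num_unlabelled_word_representable :: "nat \<Rightarrow> nat" where
  "num_unlabelled_word_representable n =
     card (word_representable_graphs n // graph_iso_on (word_representable_graphs n))"

lemma graph_iso_refl: "graph_iso G G"
  unfolding graph_iso_def by (auto intro!: exI[of _ id])

lemma graph_iso_sym:
  assumes "graph_iso G H"
  shows "graph_iso H G"
proof -
  obtain V E V' E' where GH: "G = (V, E)" "H = (V', E')" by (cases G, cases H)
  with assms obtain f where f: "bij_betw f V V'"
    and e: "\<forall>x\<in>V. \<forall>y\<in>V. {x, y} \<in> E \<longleftrightarrow> {f x, f y} \<in> E'"
    by (auto simp: graph_iso_def)
  let ?g = "inv_into V f"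
  have "bij_betw ?g V' V" using f by (rule bij_betw_inv_into)
  moreover have "{x, y} \<in> E' \<longleftrightarrow> {?g x, ?g y} \<in> E" if "x \<in> V'" "y \<in> V'" for x y
  proof -
    have "?g x \<in> V" "?g y \<in> V" using calculation that by (auto simp: bij_betw_def)
    moreover have "f (?g x) = x" "f (?g y) = y"
      using f that by (simp_all add: bij_betw_inv_into_right)
    ultimately show ?thesis using e by metis
  qed
  ultimately show ?thesis unfolding graph_iso_def GH by auto
qed

lemma graph_iso_trans:
  assumes "graph_iso G H" "graph_iso H K"
  shows "graph_iso G K"
proof -
  obtain V E V' E' V'' E'' where G: "G = (V, E)" "H = (V', E')" "K = (V'', E'')"
    by (cases G, cases H, cases K)
  with assms obtain f g where f: "bij_betw f V V'" "bij_betw g V' V''"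
    and e: "\<forall>x\<in>V. \<forall>y\<in>V. {x, y} \<in> E \<longleftrightarrow> {f x, f y} \<in> E'"
      "\<forall>x\<in>V'. \<forall>y\<in>V'. {x, y} \<in> E' \<longleftrightarrow> {g x, g y} \<in> E''"
    by (auto simp: graph_iso_def)
  have "bij_betw (g \<circ> f) V V''" using f by (rule bij_betw_trans)
  moreover have "\<forall>x\<in>V. f x \<in> V'" using f(1) by (auto simp: bij_betw_def)
  ultimately show ?thesis using e unfolding graph_iso_def G
    by (auto intro!: exI[of _ "g \<circ> f"])
qed

lemma equiv_graph_iso_on: "equiv S (graph_iso_on S)"
  by (rule equivI)
    (auto simp: graph_iso_on_def refl_on_def sym_def trans_def
      intro: graph_iso_refl graph_iso_sym graph_iso_trans)

lemma alternate_map: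
  assumes "inj_on f (set w \<union> {x, y})"
  shows "alternate (f x) (f y) (map f w) \<longleftrightarrow> alternate x y w"
proof -
  let ?u = "filter (\<lambda>z. z = x \<or> z = y) w"
  have "(\<lambda>z. z = f x \<or> z = f y) (f z) = (z = x \<or> z = y)" if "z \<in> set w" for z
    using assms that by (auto simp: inj_on_def)
  then have u: "filter (\<lambda>z. z = f x \<or> z = f y) (map f w) = map f ?u"
    by (auto simp: filter_map o_def intro!: arg_cong[of _ _ "map f"] filter_cong)
  have m: "alternating_word (f a) (f b) k = map f (alternating_word a b k)" for a b k
    by (auto simp: alternating_word_def)
  have "map f ?u = map f (alternating_word a b k) \<longleftrightarrow> ?u = alternating_word a b k"
    if "{a, b} \<subseteq> {x, y}" for a b k
  proof (rule inj_on_map_eq_map)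
    have "set ?u \<union> set (alternating_word a b k) \<subseteq> set w \<union> {x, y}"
      using that by (auto simp: alternating_word_def split: if_splits)
    then show "inj_on f (set ?u \<union> set (alternating_word a b k))"
      using assms by (rule inj_on_subset[rotated])
  qed
  then show ?thesis unfolding alternate_def u m by simp
qed

lemma ex_iso_word_representable_graphs:
  fixes G :: "'a graph"
  assumes "simple_graph G" "word_representable G" "card (fst G) = n"
  shows "\<exists>H \<in> word_representable_graphs n. graph_iso G H"
proof -
  obtain V E where G: "G = (V, E)" by (cases G)
  have V: "finite V" "card V = n" and E: "E \<subseteq> {e. e \<subseteq> V \<and> card e = 2}"
    using assms by (auto simp: G simple_graph_def)
  then obtain f where f: "bij_betw f V {1..n}"
    by (metis card_atLeastAtMost diff_Suc_1 finite_atLeastAtMost finite_same_card_bij)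
  then have inj: "inj_on f V" and img: "f ` V = {1..n}" by (auto simp: bij_betw_def)
  let ?E = "(`) f ` E"
  have edge: "{f x, f y} \<in> ?E \<longleftrightarrow> {x, y} \<in> E" if "x \<in> V" "y \<in> V" for x y
  proof
    assume "{f x, f y} \<in> ?E"
    then obtain e where e: "e \<in> E" "f ` e = f ` {x, y}" by auto
    moreover have "e \<subseteq> V" using e(1) E by auto
    moreover have "{x, y} \<subseteq> V" using that by simp
    ultimately have "e = {x, y}" using inj_on_image_eq_iff[OF inj] by blast
    with e show "{x, y} \<in> E" by simp
  next
    assume "{x, y} \<in> E"
    then have "f ` {x, y} \<in> ?E" by (rule imageI)
    moreover have "f ` {x, y} = {f x, f y}" by simp
    ultimately show "{f x, f y} \<in> ?E" by (simp only:)
  qed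
  have sub: "f ` e \<subseteq> {1..n} \<and> card (f ` e) = 2" if "e \<in> E" for e
  proof -
    have e: "e \<subseteq> V" "card e = 2" using E that by auto
    have "f ` e \<subseteq> {1..n}" using e(1) img by blast
    moreover have "card (f ` e) = 2"
      using card_image[OF inj_on_subset[OF inj e(1)]] e(2) by simp
    ultimately show ?thesis by simp
  qed
  have "simple_graph ({1..n}, ?E)" using sub unfolding simple_graph_def by blast
  moreover have "word_representable ({1..n}, ?E)"
  proof -
    obtain w where w: "set w = V"
      "\<forall>x\<in>V. \<forall>y\<in>V. x \<noteq> y \<longrightarrow> (alternate x y w \<longleftrightarrow> {x, y} \<in> E)"
      using assms(2) by (auto simp: G word_representable_def)
    have "alternate (f x) (f y) (map f w) \<longleftrightarrow> {f x, f y} \<in> ?E"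
      if "x \<in> V" "y \<in> V" "f x \<noteq> f y" for x y
    proof -
      have "inj_on f (set w \<union> {x, y})" using inj w(1) that by (simp add: insert_absorb)
      then have "alternate (f x) (f y) (map f w) \<longleftrightarrow> alternate x y w"
        by (rule alternate_map)
      moreover have "alternate x y w \<longleftrightarrow> {x, y} \<in> E" using w(2) that by auto
      ultimately show ?thesis using edge[OF that(1,2)] by (simp only:)
    qed
    moreover have "set (map f w) = {1..n}" using w(1) img by simp
    ultimately show ?thesis
      unfolding word_representable_def prod.case img[symmetric] by blast
  qed
  moreover have "graph_iso G ({1..n}, ?E)"
    unfolding graph_iso_def G prod.case using f edge by blast
  ultimately show ?thesis
    unfolding word_representable_graphs_def by blast
qed

end

theory Submission
  imports Defs "HOL-Analysis.Convex"
begin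

text \<open>Upper bound. Order the letters of a word by first occurrence. Comparing the numbers of
  occurrences in prefixes shows that if \<open>a < b < c < d\<close> and \<open>ab\<close>, \<open>bc\<close>, \<open>cd\<close>, \<open>ad\<close> are edges, then so
  is \<open>ac\<close>. Since each isomorphism class contains such an ordered graph, it suffices to count these.
  Take a weakly (Frieze--Kannan) regular partition of the edges and of the non-edges. The ordered
  pairs lying in cells where both densities exceed \<open>\<eta>\<close> span few copies of \<open>K\<^sub>4\<close>, because by the counting
  lemma each copy contributes forbidden configurations, so by Moon and Moser there are at most
  \<open>(1/3 + \<gamma>) n\<^sup>2\<close> such pairs. On all other pairs the graph is determined up to \<open>\<eta> n\<^sup>2\<close> exceptions, and
  there are only \<open>2\<^bsup>O(n)\<^esup>\<close> partitions.

  Lower bound. Every 3-partite graph is represented by an explicit word, which gives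
  \<open>2\<^bsup>n\<^sup>2/3 - O(n)\<^esup>\<close> labelled graphs, and an isomorphism class contains at most \<open>n\<^sup>n\<close> of them.\<close>

section \<open>Weak regularity\<close>

text \<open>A forbidden quadruple combines four edges with one non-edge, so the class is not closed
  under deleting edges: edges and non-edges have to be regularised by one common partition, and the
  graph is free only where both have substantial density. On many free quadruples the averaged
  kernels would have positive total weight, while the true count is exactly zero, so the
  contradiction comes from the cut-norm error alone. The pattern leaves \<open>bd\<close> open, yet
  its threshold is that of four-cliques: with \<open>a < b < c < d\<close> and edges
  \<open>ab\<close>, \<open>bc\<close>, \<open>cd\<close>, no split of the line into three intervals
  avoids an edge inside one of them, whereas the pairs between three intervals avoid the pattern.
  This is why both bounds meet at n^2/3. Any clique on four vertices, sorted by its labels, contains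
  the five pairs of the pattern, so supersaturation is applied to an unordered graph. The number of
  cells is fixed before n grows, and isomorphism changes the exponent by at most n log n.\<close>

definition cell_avg :: "'a set \<Rightarrow> ('a \<Rightarrow> 'b) \<Rightarrow> ('a \<Rightarrow> real) \<Rightarrow> 'a \<Rightarrow> real" where
  "cell_avg X q f x = (\<Sum>y | y \<in> X \<and> q y = q x. f y) / real (card {y \<in> X. q y = q x})"

lemma cell_avg_cong: "q x = q y \<Longrightarrow> cell_avg X q f x = cell_avg X q f y"
  by (simp add: cell_avg_def)

lemma cell_avg_nonneg: "(\<And>x. x \<in> X \<Longrightarrow> 0 \<le> f x) \<Longrightarrow> 0 \<le> cell_avg X q f x"
  by (auto simp: cell_avg_def intro!: divide_nonneg_nonneg sum_nonneg)

lemma cell_avg_le_1: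
  assumes "\<And>x. x \<in> X \<Longrightarrow> f x \<le> 1"
  shows "cell_avg X q f x \<le> 1"
proof -
  have "(\<Sum>y | y \<in> X \<and> q y = q x. f y) \<le> (\<Sum>y | y \<in> X \<and> q y = q x. 1)"
    by (rule sum_mono) (use assms in auto)
  then show ?thesis by (auto simp: cell_avg_def divide_le_eq_1)
qed

text \<open>\<open>cell_avg\<close> is conditional expectation on the fibres of \<open>q\<close>.
  Each \<open>f y\<close> is spread evenly over its own fibre, on which \<open>h \<circ> q\<close>
  is constant, so summing against \<open>h \<circ> q\<close> sees no difference.\<close>

lemma sum_cell_avg_mult:
  assumes "finite X"
  shows "(\<Sum>x\<in>X. cell_avg X q f x * h (q x)) = (\<Sum>x\<in>X. f x * h (q x))"
proof -
  have "(\<Sum>x\<in>X. cell_avg X q f x * h (q x))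
      = (\<Sum>x\<in>X. \<Sum>y | y \<in> X \<and> q y = q x. f y * h (q y) / card {z\<in>X. q z = q y})"
    by (auto simp: cell_avg_def sum_divide_distrib sum_distrib_right intro!: sum.cong)
  also have "\<dots> = (\<Sum>x\<in>X. \<Sum>y\<in>X. if q y = q x then f y * h (q y) / card {z\<in>X. q z = q y} else 0)"
    using assms by (simp add: sum.inter_filter) (auto intro!: sum.cong)
  also have "\<dots> = (\<Sum>y\<in>X. \<Sum>x\<in>X. if q y = q x then f y * h (q y) / card {z\<in>X. q z = q y} else 0)"
    by (rule sum.swap)
  also have "\<dots> = (\<Sum>y\<in>X. f y * h (q y))"
  proof (rule sum.cong[OF refl])
    fix y assume y: "y \<in> X"
    let ?c = "card {z\<in>X. q z = q y}"
    have "?c > 0" using y assms by (auto simp: card_gt_0_iff)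
    moreover have "(\<Sum>x\<in>X. if q y = q x then f y * h (q y) / ?c else 0)
        = (\<Sum>x | x \<in> X \<and> q y = q x. f y * h (q y) / ?c)"
      using assms by (simp add: sum.inter_filter) (auto intro!: sum.cong)
    moreover have "{x \<in> X. q y = q x} = {z\<in>X. q z = q y}" by auto
    ultimately show "(\<Sum>x\<in>X. if q y = q x then f y * h (q y) / ?c else 0) = f y * h (q y)"
      by simp
  qed
  finally show ?thesis .
qed

text \<open>Pythagoras: averaging is the orthogonal projection onto the functions constant on cells.\<close>

lemma cell_avg_refine_energy:
  assumes "finite X" and r: "\<And>x. x \<in> X \<Longrightarrow> q x = r (q' x)"
  shows "(\<Sum>x\<in>X. (cell_avg X q' f x - cell_avg X q f x)\<^sup>2)
       = (\<Sum>x\<in>X. (cell_avg X q' f x)\<^sup>2) - (\<Sum>x\<in>X. (cell_avg X q f x)\<^sup>2)"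
proof -
  \<comment> \<open>Averages are rewritten as functions of the label so that
    \<open>sum_cell_avg_mult\<close> applies, first for \<open>q'\<close> by way of \<open>r\<close>
    and then for \<open>q\<close>.\<close>
  define h where "h c = cell_avg X q f (SOME x. x \<in> X \<and> q x = c)" for c
  have h: "cell_avg X q f x = h (q x)" if "x \<in> X" for x
    unfolding h_def by (rule cell_avg_cong) (use someI[of "\<lambda>y. y \<in> X \<and> q y = q x" x] that in auto)
  have "(\<Sum>x\<in>X. cell_avg X q' f x * cell_avg X q f x)
      = (\<Sum>x\<in>X. cell_avg X q' f x * (h \<circ> r) (q' x))"
    by (auto intro!: sum.cong simp: h r)
  also have "\<dots> = (\<Sum>x\<in>X. f x * h (q x))"
    unfolding sum_cell_avg_mult[OF assms(1)] by (auto intro!: sum.cong simp: r)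
  also have "\<dots> = (\<Sum>x\<in>X. cell_avg X q f x * h (q x))"
    by (rule sum_cell_avg_mult[OF assms(1), symmetric])
  also have "\<dots> = (\<Sum>x\<in>X. (cell_avg X q f x)\<^sup>2)"
    by (auto intro!: sum.cong simp: h power2_eq_square)
  finally show ?thesis
    by (simp add: power2_diff sum.distrib sum_subtractf mult.assoc flip: sum_distrib_left)
qed

text \<open>The Frieze-Kannan condition: the error is tested on rectangles only, all cells together.
  Cells of pairs are products of vertex classes, so a partition is specified by one label per
  vertex.\<close>

definition cut_regular :: "'a set \<Rightarrow> ('a \<Rightarrow> nat) \<Rightarrow> real \<Rightarrow> ('a \<times> 'a \<Rightarrow> real) \<Rightarrow> bool" where
  "cut_regular V p \<epsilon> f \<longleftrightarrow> (\<forall>S T. S \<subseteq> V \<longrightarrow> T \<subseteq> V \<longrightarrow>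
     \<bar>\<Sum>x\<in>S \<times> T. f x - cell_avg (V \<times> V) (map_prod p p) f x\<bar> \<le> \<epsilon> * (real (card V))\<^sup>2)"

definition energy :: "'a set \<Rightarrow> ('a \<Rightarrow> nat) \<Rightarrow> ('a \<times> 'a \<Rightarrow> real) \<Rightarrow> real" where
  "energy V p f = (\<Sum>x\<in>V \<times> V. (cell_avg (V \<times> V) (map_prod p p) f x)\<^sup>2)"

lemma energy_mono:
  assumes "finite V" "\<And>v. v \<in> V \<Longrightarrow> p v = r (p' v)"
  shows "energy V p f \<le> energy V p' f"
proof -
  have "0 \<le> (\<Sum>x\<in>V \<times> V. (cell_avg (V \<times> V) (map_prod p' p') f x - cell_avg (V \<times> V) (map_prod p p) f x)\<^sup>2)"
    by (auto intro!: sum_nonneg)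
  also have "\<dots> = energy V p' f - energy V p f"
    unfolding energy_def by (rule cell_avg_refine_energy[where r = "map_prod r r"]) (use assms in auto)
  finally show ?thesis by simp
qed

text \<open>A rectangle \<open>S \<times> T\<close> violating regularity is added to the partition.
  Its indicator is then constant on cells, so on it \<open>f\<close> may be replaced by its finer
  average, and Cauchy-Schwarz with Pythagoras turns the discrepancy into an energy gain.\<close>

lemma energy_increment:
  assumes fin: "finite V" and pk: "p \<in> V \<rightarrow> {..<k}" and "\<not> cut_regular V p \<epsilon> f" and "\<epsilon> \<ge> 0"
  obtains p' where "p' \<in> V \<rightarrow> {..<4 * k}" "\<And>v. p v = p' v div 4"
    "energy V p' f \<ge> energy V p f + \<epsilon>\<^sup>2 * (real (card V))\<^sup>2"
proof -
  let ?n = "real (card V)"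
  obtain S T where ST: "S \<subseteq> V" "T \<subseteq> V"
    and big: "\<bar>\<Sum>x\<in>S \<times> T. f x - cell_avg (V \<times> V) (map_prod p p) f x\<bar> > \<epsilon> * ?n\<^sup>2"
    using assms(3) by (force simp: cut_regular_def not_le)
  \<comment> \<open>The two lowest binary digits record membership in \<open>S\<close> and in
    \<open>T\<close>: \<open>div 4\<close> recovers the old label, and \<open>h\<close> reads the
    indicator of \<open>S \<times> T\<close> off the new labels.\<close>
  define p' where "p' v = 4 * p v + 2 * of_bool (v \<in> S) + of_bool (v \<in> T)" for v
  have p: "p v = p' v div 4" for v by (simp add: p'_def of_bool_def) arith
  let ?X = "V \<times> V"
  let ?q = "map_prod p p" and ?q' = "map_prod p' p'"
  let ?A = "cell_avg ?X ?q f" and ?B = "cell_avg ?X ?q' f"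
  define h where "h x = (of_bool (fst x div 2 mod 2 = 1 \<and> snd x mod 2 = 1) :: real)" for x :: "nat \<times> nat"
  have h: "h (?q' x) = of_bool (x \<in> S \<times> T)" for x
    by (cases x) (auto simp: h_def p'_def div_add1_eq; arith)
  have finX: "finite ?X" using fin by simp
  have ST_sum: "(\<Sum>x\<in>S \<times> T. g x) = (\<Sum>x\<in>?X. g x * h (?q' x))" for g :: "_ \<Rightarrow> real"
  proof -
    have "(\<Sum>x\<in>?X. g x * h (?q' x)) = (\<Sum>x\<in>?X. if x \<in> S \<times> T then g x else 0)"
      unfolding h by (rule sum.cong) auto
    also have "\<dots> = sum g (?X \<inter> S \<times> T)" by (rule sum.inter_restrict[OF finX, symmetric])
    also have "?X \<inter> S \<times> T = S \<times> T" using ST by auto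
    finally show ?thesis by simp
  qed
  have "(\<Sum>x\<in>S \<times> T. f x - ?A x) = (\<Sum>x\<in>S \<times> T. ?B x - ?A x)"
    using sum_cell_avg_mult[OF finX, of ?q' f h] unfolding ST_sum
    by (simp add: left_diff_distrib sum_subtractf)
  then have eq: "(\<Sum>x\<in>S \<times> T. f x - ?A x) = (\<Sum>x\<in>?X. (?B x - ?A x) * h (?q' x))"
    unfolding ST_sum by simp
  have "(\<epsilon> * ?n\<^sup>2)\<^sup>2 \<le> (\<Sum>x\<in>S \<times> T. f x - ?A x)\<^sup>2"
    using big assms(4) by (intro abs_le_square_iff[THEN iffD1]) auto
  also have "\<dots> \<le> (\<Sum>x\<in>?X. (?B x - ?A x)\<^sup>2) * (\<Sum>x\<in>?X. (h (?q' x))\<^sup>2)"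
    unfolding eq by (rule Cauchy_Schwarz_ineq_sum)
  also have "\<dots> \<le> (\<Sum>x\<in>?X. (?B x - ?A x)\<^sup>2) * ?n\<^sup>2"
  proof (rule mult_left_mono)
    have "(\<Sum>x\<in>?X. (h (?q' x))\<^sup>2) \<le> (\<Sum>x\<in>?X. 1)"
      by (rule sum_mono) (auto simp: h)
    then show "(\<Sum>x\<in>?X. (h (?q' x))\<^sup>2) \<le> ?n\<^sup>2"
      by (simp add: card_cartesian_product power2_eq_square)
  qed (auto intro: sum_nonneg)
  also have "(\<Sum>x\<in>?X. (?B x - ?A x)\<^sup>2) = energy V p' f - energy V p f"
    unfolding energy_def
    by (rule cell_avg_refine_energy[where r = "map_prod (\<lambda>i. i div 4) (\<lambda>i. i div 4)"]) (use fin p in auto)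
  finally have *: "(\<epsilon>\<^sup>2 * ?n\<^sup>2) * ?n\<^sup>2 \<le> (energy V p' f - energy V p f) * ?n\<^sup>2"
    by (simp add: power_mult_distrib power2_eq_square mult_ac)
  have "V \<noteq> {}" using big ST by auto
  then have "?n\<^sup>2 > 0" using fin by auto
  then have "energy V p' f \<ge> energy V p f + \<epsilon>\<^sup>2 * ?n\<^sup>2" using * by simp
  moreover have "p' \<in> V \<rightarrow> {..<4 * k}"
  proof
    fix v assume "v \<in> V"
    then have "p v < k" using pk by auto
    then show "p' v \<in> {..<4 * k}" by (auto simp: p'_def of_bool_def)
  qed
  ultimately show ?thesis using that p by blast
qed

text \<open>Each failing round adds \<open>\<epsilon>\<^sup>2 * n\<^sup>2\<close> to a total energy
  of at most \<open>card I * n\<^sup>2\<close>, so fewer than \<open>K\<close> rounds fail. Refining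
  never lowers the energy of the other kernels, which is why one partition serves the whole
  family.\<close>

theorem weak_regularity:
  fixes f :: "'i \<Rightarrow> 'a \<times> 'a \<Rightarrow> real"
  assumes "finite V" "finite I" "\<epsilon> > 0" and K: "real K * \<epsilon>\<^sup>2 > real (card I)"
    and f01: "\<And>i x. i \<in> I \<Longrightarrow> x \<in> V \<times> V \<Longrightarrow> 0 \<le> f i x \<and> f i x \<le> 1"
  obtains p where "p \<in> V \<rightarrow> {..<4 ^ K}" "\<And>i. i \<in> I \<Longrightarrow> cut_regular V p \<epsilon> (f i)"
proof (cases "V = {}")
  case True
  then show ?thesis using that[of "\<lambda>_. 0"] assms(3) by (auto simp: cut_regular_def)
next
  case False
  let ?n = "real (card V)"
  define En where "En p = (\<Sum>i\<in>I. energy V p (f i))" for p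
  \<comment> \<open>The first disjunct lets the induction continue after success: the same
    \<open>p\<close> is kept, its labels being below the next power as well.\<close>
  have "\<exists>p. p \<in> V \<rightarrow> {..<4 ^ j} \<and> ((\<forall>i\<in>I. cut_regular V p \<epsilon> (f i)) \<or> En p \<ge> real j * (\<epsilon>\<^sup>2 * ?n\<^sup>2))" for j
  proof (induction j)
    case 0
    have "En p \<ge> 0" for p by (auto simp: En_def energy_def intro!: sum_nonneg)
    then show ?case by (auto intro!: exI[of _ "\<lambda>_. 0"])
  next
    case (Suc j)
    then obtain p where p: "p \<in> V \<rightarrow> {..<4 ^ j}"
      "(\<forall>i\<in>I. cut_regular V p \<epsilon> (f i)) \<or> En p \<ge> real j * (\<epsilon>\<^sup>2 * ?n\<^sup>2)" by blast
    show ?case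
    proof (cases "\<forall>i\<in>I. cut_regular V p \<epsilon> (f i)")
      case True
      then show ?thesis using p(1) by (auto intro!: exI[of _ p] simp: Pi_iff)
    next
      case False
      then obtain i where i: "i \<in> I" "\<not> cut_regular V p \<epsilon> (f i)" by blast
      obtain p' where p': "p' \<in> V \<rightarrow> {..<4 * 4 ^ j}" "\<And>v. p v = p' v div 4"
        "energy V p' (f i) \<ge> energy V p (f i) + \<epsilon>\<^sup>2 * ?n\<^sup>2"
        using energy_increment[OF assms(1) p(1) i(2)] assms(3) by auto
      have "(\<Sum>l\<in>I - {i}. energy V p (f l)) \<le> (\<Sum>l\<in>I - {i}. energy V p' (f l))"
        by (intro sum_mono energy_mono[where r = "\<lambda>i. i div 4"] assms(1) p'(2))
      then have "En p' \<ge> En p + \<epsilon>\<^sup>2 * ?n\<^sup>2"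
        using p'(3) by (simp add: En_def sum.remove[OF assms(2) i(1)])
      then have "En p' \<ge> real (Suc j) * (\<epsilon>\<^sup>2 * ?n\<^sup>2)" using p(2) False by (simp add: distrib_right)
      then show ?thesis using p'(1) by auto
    qed
  qed
  then obtain p where p: "p \<in> V \<rightarrow> {..<4 ^ K}"
    "(\<forall>i\<in>I. cut_regular V p \<epsilon> (f i)) \<or> En p \<ge> real K * (\<epsilon>\<^sup>2 * ?n\<^sup>2)" by blast
  have "En p \<le> (\<Sum>i\<in>I. ?n\<^sup>2)" unfolding En_def
  proof (rule sum_mono)
    fix i assume i: "i \<in> I"
    have "energy V p (f i) \<le> (\<Sum>x\<in>V \<times> V. 1)" unfolding energy_def
      by (intro sum_mono power_le_one cell_avg_nonneg cell_avg_le_1) (use f01 i in auto)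
    then show "energy V p (f i) \<le> ?n\<^sup>2" by (simp add: card_cartesian_product power2_eq_square)
  qed
  also have "\<dots> = card I * ?n\<^sup>2" by simp
  also have "\<dots> < real K * \<epsilon>\<^sup>2 * ?n\<^sup>2"
    using K False assms(1) by (intro mult_strict_right_mono) auto
  finally show ?thesis using p that by (auto simp: mult.assoc)
qed

section \<open>Counting in the cut norm\<close>

text \<open>The form is linear in \<open>f\<close> and in \<open>g\<close> separately, so weights in
  the unit interval do no better than indicators: \<open>S\<close> keeps the rows with positive sum,
  then \<open>T\<close> the columns.\<close>

lemma cut_norm_bilinear:
  fixes D :: "'a \<times> 'a \<Rightarrow> real"
  assumes fin: "finite V"
    and cut: "\<And>S T. S \<subseteq> V \<Longrightarrow> T \<subseteq> V \<Longrightarrow> \<bar>\<Sum>x\<in>S \<times> T. D x\<bar> \<le> c"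
    and f: "\<And>u. u \<in> V \<Longrightarrow> 0 \<le> f u \<and> f u \<le> 1"
    and g: "\<And>u. u \<in> V \<Longrightarrow> 0 \<le> g u \<and> g u \<le> 1"
  shows "(\<Sum>u\<in>V. \<Sum>v\<in>V. D (u, v) * f u * g v) \<le> c"
proof -
  have lin: "(\<Sum>u\<in>V. h u * k u) \<le> (\<Sum>u | u \<in> V \<and> h u > 0. h u)"
    if "\<And>u. u \<in> V \<Longrightarrow> 0 \<le> k u \<and> k u \<le> 1" for h k :: "'a \<Rightarrow> real"
  proof -
    have "h u * k u \<le> (if h u > 0 then h u else 0)" if "u \<in> V" for u
      using \<open>\<And>u. u \<in> V \<Longrightarrow> 0 \<le> k u \<and> k u \<le> 1\<close>[OF that]
      by (auto simp: mult_left_le mult_nonpos_nonneg)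
    then have "(\<Sum>u\<in>V. h u * k u) \<le> (\<Sum>u\<in>V. if h u > 0 then h u else 0)"
      by (rule sum_mono)
    then show ?thesis using fin by (simp add: sum.inter_filter)
  qed
  define S where "S = {u \<in> V. (\<Sum>v\<in>V. D (u, v) * g v) > 0}"
  define T where "T = {v \<in> V. (\<Sum>u\<in>S. D (u, v)) > 0}"
  have "(\<Sum>u\<in>V. \<Sum>v\<in>V. D (u, v) * f u * g v) = (\<Sum>u\<in>V. (\<Sum>v\<in>V. D (u, v) * g v) * f u)"
    by (simp add: sum_distrib_left sum_distrib_right mult_ac)
  also have "\<dots> \<le> (\<Sum>u\<in>S. \<Sum>v\<in>V. D (u, v) * g v)"
    unfolding S_def by (rule lin[OF f])
  also have "\<dots> = (\<Sum>v\<in>V. (\<Sum>u\<in>S. D (u, v)) * g v)"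
    by (subst sum.swap) (simp add: sum_distrib_right)
  also have "\<dots> \<le> (\<Sum>v\<in>T. \<Sum>u\<in>S. D (u, v))"
    unfolding T_def by (rule lin[OF g])
  also have "\<dots> = (\<Sum>x\<in>S \<times> T. D x)"
    by (subst sum.swap) (simp add: sum.cartesian_product)
  also have "\<dots> \<le> c"
    using cut[of S T] by (auto simp: S_def T_def)
  finally show ?thesis .
qed

lemma prod_diff_telescope5:
  fixes a b c d e a' b' c' d' e' :: real
  shows "a' * b' * c' * d' * e' - a * b * c * d * e =
    (a' - a) * b' * c' * d' * e' + a * (b' - b) * c' * d' * e' + a * b * (c' - c) * d' * e'
    + a * b * c * (d' - d) * e' + a * b * c * d * (e' - e)"
  by (simp add: algebra_simps)

lemma mult_unit_interval:
  fixes a b :: real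
  shows "0 \<le> a \<and> a \<le> 1 \<Longrightarrow> 0 \<le> b \<and> b \<le> 1 \<Longrightarrow> 0 \<le> a * b \<and> a * b \<le> 1"
  by (simp add: mult_le_one)

text \<open>The five kernels sit on the edges of a 4-cycle with one chord; replacing them one at a time
  costs at most one cut norm each.\<close>

lemma counting_lemma:
  fixes M W M' W' :: "'a \<times> 'a \<Rightarrow> real"
  assumes fin: "finite V"
    and cut: "\<And>S T. S \<subseteq> V \<Longrightarrow> T \<subseteq> V \<Longrightarrow> \<bar>\<Sum>x\<in>S \<times> T. W x - M x\<bar> \<le> \<epsilon> * (real (card V))\<^sup>2"
    and cut': "\<And>S T. S \<subseteq> V \<Longrightarrow> T \<subseteq> V \<Longrightarrow> \<bar>\<Sum>x\<in>S \<times> T. W' x - M' x\<bar> \<le> \<epsilon> * (real (card V))\<^sup>2"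
    and M: "\<And>x. x \<in> V \<times> V \<Longrightarrow> 0 \<le> M x \<and> M x \<le> 1" and W: "\<And>x. x \<in> V \<times> V \<Longrightarrow> 0 \<le> W x \<and> W x \<le> 1"
    and M': "\<And>x. x \<in> V \<times> V \<Longrightarrow> 0 \<le> M' x \<and> M' x \<le> 1" and W': "\<And>x. x \<in> V \<times> V \<Longrightarrow> 0 \<le> W' x \<and> W' x \<le> 1"
  shows "(\<Sum>a\<in>V. \<Sum>b\<in>V. \<Sum>c\<in>V. \<Sum>d\<in>V. W (a, b) * W (b, c) * W (c, d) * W (a, d) * W' (a, c))
    \<le> (\<Sum>a\<in>V. \<Sum>b\<in>V. \<Sum>c\<in>V. \<Sum>d\<in>V. M (a, b) * M (b, c) * M (c, d) * M (a, d) * M' (a, c))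
      + 5 * \<epsilon> * real (card V) ^ 4"
proof -
  let ?n = "real (card V)"
  let ?D = "\<lambda>x. W x - M x" and ?D' = "\<lambda>x. W' x - M' x"
  \<comment> \<open>With the other two variables fixed, each remaining kernel contains at most one
    of \<open>u\<close> and \<open>v\<close>, so the product splits into \<open>f\<close> and
    \<open>g\<close> and the cut norm applies. The sums below are reordered to bring the replaced
    pair innermost.\<close>
  have lift: "(\<Sum>s\<in>V. \<Sum>t\<in>V. \<Sum>u\<in>V. \<Sum>v\<in>V. K (u, v) * (f s t u * g s t v)) \<le> \<epsilon> * ?n ^ 4"
    if "\<And>S T. S \<subseteq> V \<Longrightarrow> T \<subseteq> V \<Longrightarrow> \<bar>\<Sum>x\<in>S \<times> T. K x\<bar> \<le> \<epsilon> * ?n\<^sup>2"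
      and "\<And>s t u. s \<in> V \<Longrightarrow> t \<in> V \<Longrightarrow> u \<in> V \<Longrightarrow> 0 \<le> f s t u \<and> f s t u \<le> 1"
      and "\<And>s t u. s \<in> V \<Longrightarrow> t \<in> V \<Longrightarrow> u \<in> V \<Longrightarrow> 0 \<le> g s t u \<and> g s t u \<le> 1"
    for K :: "'a \<times> 'a \<Rightarrow> real" and f g
  proof -
    have "(\<Sum>s\<in>V. \<Sum>t\<in>V. \<Sum>u\<in>V. \<Sum>v\<in>V. K (u, v) * (f s t u * g s t v)) \<le> (\<Sum>s\<in>V. \<Sum>t\<in>V. \<epsilon> * ?n\<^sup>2)"
    proof (intro sum_mono)
      fix s t assume "s \<in> V" "t \<in> V"
      then show "(\<Sum>u\<in>V. \<Sum>v\<in>V. K (u, v) * (f s t u * g s t v)) \<le> \<epsilon> * ?n\<^sup>2"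
        using cut_norm_bilinear[OF fin that(1), of "f s t" "g s t"] that(2,3) by (simp add: mult.assoc)
    qed
    then show ?thesis by (simp add: power_numeral_reduce mult_ac)
  qed
  note unit = mult_unit_interval M W M' W'
  have 1: "(\<Sum>a\<in>V. \<Sum>b\<in>V. \<Sum>c\<in>V. \<Sum>d\<in>V. (W (a, b) - M (a, b)) * W (b, c) * W (c, d) * W (a, d) * W' (a, c))
      \<le> \<epsilon> * ?n ^ 4"
  proof -
    have "(\<Sum>a\<in>V. \<Sum>b\<in>V. \<Sum>c\<in>V. \<Sum>d\<in>V. (W (a, b) - M (a, b)) * W (b, c) * W (c, d) * W (a, d) * W' (a, c))
      = (\<Sum>a\<in>V. \<Sum>c\<in>V. \<Sum>b\<in>V. \<Sum>d\<in>V. (W (a, b) - M (a, b)) * W (b, c) * W (c, d) * W (a, d) * W' (a, c))"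
      by (rule sum.cong[OF refl], rule sum.swap)
    also have "\<dots> = (\<Sum>c\<in>V. \<Sum>a\<in>V. \<Sum>d\<in>V. \<Sum>b\<in>V. (W (a, b) - M (a, b)) * W (b, c) * W (c, d) * W (a, d) * W' (a, c))"
      by (subst sum.swap, rule sum.cong[OF refl], rule sum.cong[OF refl], rule sum.swap)
    also have "\<dots> = (\<Sum>c\<in>V. \<Sum>d\<in>V. \<Sum>a\<in>V. \<Sum>b\<in>V. ?D (a, b) * ((W (c, d) * W (a, d) * W' (a, c)) * W (b, c)))"
      by (rule sum.cong[OF refl], subst sum.swap) (simp add: mult_ac)
    also have "\<dots> \<le> \<epsilon> * ?n ^ 4"
      by (intro lift[where K = ?D] cut unit) auto
    finally show ?thesis .
  qed
  have 2: "(\<Sum>a\<in>V. \<Sum>b\<in>V. \<Sum>c\<in>V. \<Sum>d\<in>V. M (a, b) * (W (b, c) - M (b, c)) * W (c, d) * W (a, d) * W' (a, c))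
      \<le> \<epsilon> * ?n ^ 4"
  proof -
    have "(\<Sum>a\<in>V. \<Sum>b\<in>V. \<Sum>c\<in>V. \<Sum>d\<in>V. M (a, b) * (W (b, c) - M (b, c)) * W (c, d) * W (a, d) * W' (a, c))
      = (\<Sum>a\<in>V. \<Sum>b\<in>V. \<Sum>d\<in>V. \<Sum>c\<in>V. M (a, b) * (W (b, c) - M (b, c)) * W (c, d) * W (a, d) * W' (a, c))"
      by (rule sum.cong[OF refl], rule sum.cong[OF refl], rule sum.swap)
    also have "\<dots> = (\<Sum>a\<in>V. \<Sum>d\<in>V. \<Sum>b\<in>V. \<Sum>c\<in>V. ?D (b, c) * ((M (a, b) * W (a, d)) * (W (c, d) * W' (a, c))))"
      by (rule sum.cong[OF refl], subst sum.swap) (simp add: mult_ac)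
    also have "\<dots> \<le> \<epsilon> * ?n ^ 4"
      by (intro lift[where K = ?D] cut unit) auto
    finally show ?thesis .
  qed
  have 3: "(\<Sum>a\<in>V. \<Sum>b\<in>V. \<Sum>c\<in>V. \<Sum>d\<in>V. M (a, b) * M (b, c) * (W (c, d) - M (c, d)) * W (a, d) * W' (a, c))
      \<le> \<epsilon> * ?n ^ 4"
  proof -
    have "(\<Sum>a\<in>V. \<Sum>b\<in>V. \<Sum>c\<in>V. \<Sum>d\<in>V. M (a, b) * M (b, c) * (W (c, d) - M (c, d)) * W (a, d) * W' (a, c))
      = (\<Sum>a\<in>V. \<Sum>b\<in>V. \<Sum>c\<in>V. \<Sum>d\<in>V. ?D (c, d) * ((M (a, b) * M (b, c) * W' (a, c)) * W (a, d)))"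
      by (simp add: mult_ac)
    also have "\<dots> \<le> \<epsilon> * ?n ^ 4"
      by (intro lift[where K = ?D] cut unit) auto
    finally show ?thesis .
  qed
  have 4: "(\<Sum>a\<in>V. \<Sum>b\<in>V. \<Sum>c\<in>V. \<Sum>d\<in>V. M (a, b) * M (b, c) * M (c, d) * (W (a, d) - M (a, d)) * W' (a, c))
      \<le> \<epsilon> * ?n ^ 4"
  proof -
    have "(\<Sum>a\<in>V. \<Sum>b\<in>V. \<Sum>c\<in>V. \<Sum>d\<in>V. M (a, b) * M (b, c) * M (c, d) * (W (a, d) - M (a, d)) * W' (a, c))
      = (\<Sum>b\<in>V. \<Sum>a\<in>V. \<Sum>c\<in>V. \<Sum>d\<in>V. M (a, b) * M (b, c) * M (c, d) * (W (a, d) - M (a, d)) * W' (a, c))"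
      by (rule sum.swap)
    also have "\<dots> = (\<Sum>b\<in>V. \<Sum>c\<in>V. \<Sum>a\<in>V. \<Sum>d\<in>V. ?D (a, d) * ((M (a, b) * M (b, c) * W' (a, c)) * M (c, d)))"
      by (rule sum.cong[OF refl], subst sum.swap) (simp add: mult_ac)
    also have "\<dots> \<le> \<epsilon> * ?n ^ 4"
      by (intro lift[where K = ?D] cut unit) auto
    finally show ?thesis .
  qed
  have 5: "(\<Sum>a\<in>V. \<Sum>b\<in>V. \<Sum>c\<in>V. \<Sum>d\<in>V. M (a, b) * M (b, c) * M (c, d) * M (a, d) * (W' (a, c) - M' (a, c)))
      \<le> \<epsilon> * ?n ^ 4"
  proof -
    have "(\<Sum>a\<in>V. \<Sum>b\<in>V. \<Sum>c\<in>V. \<Sum>d\<in>V. M (a, b) * M (b, c) * M (c, d) * M (a, d) * (W' (a, c) - M' (a, c)))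
      = (\<Sum>b\<in>V. \<Sum>a\<in>V. \<Sum>d\<in>V. \<Sum>c\<in>V. M (a, b) * M (b, c) * M (c, d) * M (a, d) * (W' (a, c) - M' (a, c)))"
      by (subst sum.swap, rule sum.cong[OF refl], rule sum.cong[OF refl], rule sum.swap)
    also have "\<dots> = (\<Sum>b\<in>V. \<Sum>d\<in>V. \<Sum>a\<in>V. \<Sum>c\<in>V. ?D' (a, c) * ((M (a, b) * M (a, d)) * (M (b, c) * M (c, d))))"
      by (rule sum.cong[OF refl], subst sum.swap) (simp add: mult_ac)
    also have "\<dots> \<le> \<epsilon> * ?n ^ 4"
      by (intro lift[where K = ?D'] cut' unit) auto
    finally show ?thesis .
  qed
  have "(\<Sum>a\<in>V. \<Sum>b\<in>V. \<Sum>c\<in>V. \<Sum>d\<in>V. W (a, b) * W (b, c) * W (c, d) * W (a, d) * W' (a, c))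
    - (\<Sum>a\<in>V. \<Sum>b\<in>V. \<Sum>c\<in>V. \<Sum>d\<in>V. M (a, b) * M (b, c) * M (c, d) * M (a, d) * M' (a, c)) \<le> 5 * \<epsilon> * ?n ^ 4"
    unfolding sum_subtractf[symmetric] prod_diff_telescope5 sum.distrib
    using 1 2 3 4 5 by linarith
  then show ?thesis by linarith
qed

section \<open>Supersaturation for complete graphs on four vertices\<close>

text \<open>The Moon--Moser inequalities, with homomorphism counts instead of clique counts.\<close>

lemma K4_supersaturation:
  fixes g :: "'a \<Rightarrow> 'a \<Rightarrow> real" and V :: "'a set"
  assumes fin: "finite V" and sym: "\<And>a b. g a b = g b a" and g01: "\<And>a b. g a b \<in> {0, 1}" and "\<gamma> \<ge> 0"
    and dense: "(2 / 3 + 2 * \<gamma>) * (real (card V))\<^sup>2 \<le> (\<Sum>a\<in>V. \<Sum>b\<in>V. g a b)"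
  shows "\<gamma> * real (card V) ^ 4
    \<le> (\<Sum>a\<in>V. \<Sum>b\<in>V. \<Sum>c\<in>V. \<Sum>d\<in>V. g a b * g b c * g a c * (g a d * g b d * g c d))"
proof (cases "V = {}")
  case True
  then show ?thesis by simp
next
  case False
  define n where "n = real (card V)"
  have n: "n > 0" using False fin by (simp add: n_def card_gt_0_iff)
  have g_nonneg: "g a b \<ge> 0" for a b using g01[of a b] by auto
  have g_idem: "g a b * g a b = g a b" for a b using g01[of a b] by auto
  define D where "D a = (\<Sum>b\<in>V. g a b)" for a
  define d where "d a b = (\<Sum>c\<in>V. g a c * g b c)" for a b
  define K2 where "K2 = (\<Sum>a\<in>V. D a)"
  define K3 where "K3 = (\<Sum>a\<in>V. \<Sum>b\<in>V. g a b * d a b)"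
  define K4 where "K4 = (\<Sum>a\<in>V. \<Sum>b\<in>V. \<Sum>c\<in>V. \<Sum>d\<in>V. g a b * g b c * g a c * (g a d * g b d * g c d))"
  have K2_ge: "K2 \<ge> (2 / 3 + 2 * \<gamma>) * n\<^sup>2" using dense by (simp add: K2_def D_def n_def)
  then have K2_pos: "K2 > 0" using n \<open>\<gamma> \<ge> 0\<close> by (smt (verit) divide_pos_pos mult_pos_pos zero_less_power)
  \<comment> \<open>Neighbourhoods of sizes \<open>D a\<close> and \<open>D b\<close> among
    \<open>n\<close> vertices overlap in at least this many. Summed over edges, with Cauchy-Schwarz
    for the degrees, this gives the triangle step \<open>K3_K2\<close>.\<close>
  have d_ge: "d a b \<ge> D a + D b - n" for a b
  proof -
    have "D a + D b - n = (\<Sum>c\<in>V. g a c + g b c - 1)"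
      by (simp add: D_def n_def sum.distrib sum_subtractf)
    also have "\<dots> \<le> d a b"
      unfolding d_def
    proof (rule sum_mono)
      fix c
      show "g a c + g b c - 1 \<le> g a c * g b c" using g01[of a c] g01[of b c] by auto
    qed
    finally show ?thesis .
  qed
  have DD: "(\<Sum>a\<in>V. \<Sum>b\<in>V. g a b * D a) = (\<Sum>a\<in>V. (D a)\<^sup>2)"
    by (simp add: power2_eq_square flip: sum_distrib_right) (simp add: D_def)
  have DD': "(\<Sum>a\<in>V. \<Sum>b\<in>V. g a b * D b) = (\<Sum>a\<in>V. (D a)\<^sup>2)"
    by (subst sum.swap) (simp add: sym DD[symmetric])
  have "2 * (\<Sum>a\<in>V. (D a)\<^sup>2) - n * K2 = (\<Sum>a\<in>V. \<Sum>b\<in>V. g a b * (D a + D b - n))"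
  proof -
    have "(\<Sum>a\<in>V. \<Sum>b\<in>V. g a b * n) = n * K2"
      by (simp add: K2_def D_def sum_distrib_left mult.commute)
    then show ?thesis by (simp add: distrib_left right_diff_distrib sum.distrib sum_subtractf DD DD')
  qed
  also have "\<dots> \<le> K3"
    unfolding K3_def by (intro sum_mono mult_left_mono d_ge g_nonneg)
  finally have K3_ge: "2 * (\<Sum>a\<in>V. (D a)\<^sup>2) - n * K2 \<le> K3" .
  have "K2\<^sup>2 \<le> (\<Sum>a\<in>V. (D a)\<^sup>2) * n"
    using Cauchy_Schwarz_ineq_sum[of D "\<lambda>_. 1" V] by (simp add: K2_def n_def)
  then have "2 * K2 * K2 - n * K2 * n \<le> K3 * n"
    using mult_right_mono[OF K3_ge, of n] n by (simp add: power2_eq_square algebra_simps)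
  moreover have "2 * K2 \<ge> (4 / 3 + 4 * \<gamma>) * n * n" using K2_ge by (simp add: power2_eq_square algebra_simps)
  then have "(2 * K2 - n * n) * K2 \<ge> (1 / 3 + 4 * \<gamma>) * n * n * K2"
    using K2_pos by (intro mult_right_mono) (auto simp: algebra_simps)
  ultimately have "(1 / 3 + 4 * \<gamma>) * n * K2 * n \<le> K3 * n" by (simp add: algebra_simps)
  then have K3_K2: "(1 / 3 + 4 * \<gamma>) * n * K2 \<le> K3" using n by (simp add: mult_ac)
  define Q where "Q = (\<Sum>a\<in>V. \<Sum>b\<in>V. g a b * (d a b)\<^sup>2)"
  have Q1: "(\<Sum>a\<in>V. \<Sum>b\<in>V. \<Sum>c\<in>V. g a b * g b c * g a c * d a b) = Q"
    unfolding Q_def power2_eq_square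
    by (intro sum.cong refl) (simp add: sum_distrib_left sum_distrib_right d_def mult_ac)
  have Q2: "(\<Sum>a\<in>V. \<Sum>b\<in>V. \<Sum>c\<in>V. g a b * g b c * g a c * d a c) = Q"
  proof -
    have "(\<Sum>a\<in>V. \<Sum>b\<in>V. \<Sum>c\<in>V. g a b * g b c * g a c * d a c)
        = (\<Sum>a\<in>V. \<Sum>c\<in>V. \<Sum>b\<in>V. g a b * g b c * g a c * d a c)"
      by (rule sum.cong[OF refl], rule sum.swap)
    also have "\<dots> = (\<Sum>a\<in>V. \<Sum>c\<in>V. \<Sum>b\<in>V. g a c * g c b * g a b * d a c)"
      by (intro sum.cong refl) (simp add: sym mult_ac)
    finally show ?thesis using Q1 by simp
  qed
  have Q3: "(\<Sum>a\<in>V. \<Sum>b\<in>V. \<Sum>c\<in>V. g a b * g b c * g a c * d b c) = Q"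
  proof -
    have "(\<Sum>a\<in>V. \<Sum>b\<in>V. \<Sum>c\<in>V. g a b * g b c * g a c * d b c)
        = (\<Sum>b\<in>V. \<Sum>a\<in>V. \<Sum>c\<in>V. g a b * g b c * g a c * d b c)"
      by (rule sum.swap)
    also have "\<dots> = (\<Sum>b\<in>V. \<Sum>a\<in>V. \<Sum>c\<in>V. g b a * g a c * g b c * d b c)"
      by (intro sum.cong refl) (simp add: sym[of _ b for b] mult_ac)
    finally show ?thesis using Q2 by simp
  qed
  have K3': "(\<Sum>a\<in>V. \<Sum>b\<in>V. \<Sum>c\<in>V. g a b * g b c * g a c) = K3"
    unfolding K3_def d_def by (simp add: sum_distrib_left mult_ac)
  \<comment> \<open>The analogue for extending a triangle: for 0/1 values, \<open>x * y * z\<close>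
    is at least \<open>(x * y + x * z + y * z - 1) / 2\<close>. By symmetry the three codegree sums
    all equal \<open>Q\<close>.\<close>
  have ext: "(\<Sum>e\<in>V. g a e * g b e * g c e) \<ge> (d a b + d a c + d b c - n) / 2" for a b c
  proof -
    have "(d a b + d a c + d b c - n) / 2
        = (\<Sum>e\<in>V. (g a e * g b e + g a e * g c e + g b e * g c e - 1) / 2)"
      by (simp add: d_def n_def sum.distrib sum_subtractf flip: sum_divide_distrib)
    also have "\<dots> \<le> (\<Sum>e\<in>V. g a e * g b e * g c e)"
    proof (rule sum_mono)
      fix e
      show "(g a e * g b e + g a e * g c e + g b e * g c e - 1) / 2 \<le> g a e * g b e * g c e"
        using g01[of a e] g01[of b e] g01[of c e] by auto
    qed
    finally show ?thesis .
  qed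
  have "(3 * Q - n * K3) / 2
      = (\<Sum>a\<in>V. \<Sum>b\<in>V. \<Sum>c\<in>V. g a b * g b c * g a c * ((d a b + d a c + d b c - n) / 2))"
  proof -
    have "(\<Sum>a\<in>V. \<Sum>b\<in>V. \<Sum>c\<in>V. g a b * g b c * g a c * ((d a b + d a c + d b c - n) / 2))
      = ((\<Sum>a\<in>V. \<Sum>b\<in>V. \<Sum>c\<in>V. g a b * g b c * g a c * d a b)
        + (\<Sum>a\<in>V. \<Sum>b\<in>V. \<Sum>c\<in>V. g a b * g b c * g a c * d a c)
        + (\<Sum>a\<in>V. \<Sum>b\<in>V. \<Sum>c\<in>V. g a b * g b c * g a c * d b c)
        - (\<Sum>a\<in>V. \<Sum>b\<in>V. \<Sum>c\<in>V. g a b * g b c * g a c) * n) / 2"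
      by (simp add: distrib_left right_diff_distrib sum.distrib sum_subtractf sum_distrib_right
          flip: sum_divide_distrib)
    then show ?thesis unfolding Q1 Q2 Q3 K3' by simp
  qed
  also have "\<dots> \<le> (\<Sum>a\<in>V. \<Sum>b\<in>V. \<Sum>c\<in>V. g a b * g b c * g a c * (\<Sum>e\<in>V. g a e * g b e * g c e))"
    by (intro sum_mono mult_left_mono ext) (simp add: g_nonneg)
  also have "\<dots> = K4" by (simp add: K4_def sum_distrib_left)
  finally have K4_ge: "(3 * Q - n * K3) / 2 \<le> K4" .
  \<comment> \<open>Cauchy-Schwarz over the edges. With \<open>K4_ge\<close> it gives
    \<open>K3 * (3 * K3 - n * K2) \<le> 2 * K4 * K2\<close>, and by \<open>K3_K2\<close> the bracket
    is at least \<open>12 * \<gamma> * n * K2\<close>.\<close>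
  have "K3\<^sup>2 \<le> Q * K2"
  proof -
    have "K3 = (\<Sum>x\<in>V \<times> V. (g (fst x) (snd x) * d (fst x) (snd x)) * g (fst x) (snd x))"
      by (simp add: K3_def sum.cartesian_product case_prod_unfold mult_ac g_idem flip: mult.assoc)
    also have "\<dots>\<^sup>2 \<le> (\<Sum>x\<in>V \<times> V. (g (fst x) (snd x) * d (fst x) (snd x))\<^sup>2) * (\<Sum>x\<in>V \<times> V. (g (fst x) (snd x))\<^sup>2)"
      by (rule Cauchy_Schwarz_ineq_sum)
    also have "\<dots> = Q * K2"
      by (simp add: Q_def K2_def D_def sum.cartesian_product case_prod_unfold power_mult_distrib)
        (simp add: power2_eq_square g_idem)
    finally show ?thesis .
  qed
  then have "3 * K3 * K3 - n * K3 * K2 \<le> (3 * Q - n * K3) * K2"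
    by (simp add: power2_eq_square algebra_simps)
  also have "\<dots> \<le> 2 * K4 * K2"
    using K4_ge K2_pos by (intro mult_right_mono) auto
  finally have A: "3 * K3 * K3 - n * K3 * K2 \<le> 2 * K4 * K2" .
  have K3_nonneg: "K3 \<ge> 0" using K3_K2 K2_pos n \<open>\<gamma> \<ge> 0\<close>
    by (smt (verit) divide_nonneg_nonneg mult_nonneg_nonneg)
  have "K3 * ((1 + 12 * \<gamma>) * n * K2 - n * K2) \<le> K3 * (3 * K3 - n * K2)"
    using K3_K2 K3_nonneg by (intro mult_left_mono) (auto simp: algebra_simps)
  then have "(12 * \<gamma> * n * K3) * K2 \<le> (2 * K4) * K2" using A by (simp add: algebra_simps)
  then have B: "6 * \<gamma> * n * K3 \<le> K4" using K2_pos by (simp add: mult_ac)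
  \<comment> \<open>The \<open>\<gamma>\<close> terms are dropped here:
    \<open>6 * \<gamma> * n\<close> times 2/9 of \<open>n ^ 3\<close> is already 4/3 of
    \<open>\<gamma> * n ^ 4\<close>.\<close>
  have "K3 \<ge> 1 / 3 * n * (2 / 3 * n\<^sup>2)"
  proof -
    have "1 / 3 * n * (2 / 3 * n\<^sup>2) \<le> (1 / 3 + 4 * \<gamma>) * n * K2"
    proof (intro mult_mono)
      show "2 / 3 * n\<^sup>2 \<le> K2" using K2_ge \<open>\<gamma> \<ge> 0\<close>
        by (smt (verit) mult_right_mono zero_le_power2)
    qed (use n \<open>\<gamma> \<ge> 0\<close> in auto)
    then show ?thesis using K3_K2 by linarith
  qed
  then have "6 * \<gamma> * n * (1 / 3 * n * (2 / 3 * n\<^sup>2)) \<le> 6 * \<gamma> * n * K3"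
    using n \<open>\<gamma> \<ge> 0\<close> by (intro mult_left_mono) auto
  also have "6 * \<gamma> * n * (1 / 3 * n * (2 / 3 * n\<^sup>2)) = 4 / 3 * (\<gamma> * n ^ 4)"
    by (simp add: power2_eq_square power4_eq_xxxx)
  finally have "4 / 3 * (\<gamma> * n ^ 4) \<le> K4" using B by linarith
  moreover have "\<gamma> * n ^ 4 \<ge> 0" using \<open>\<gamma> \<ge> 0\<close> n by simp
  ultimately show ?thesis unfolding K4_def[symmetric] n_def[symmetric] by linarith
qed

section \<open>Ordered graphs without shortcuts\<close>

definition fwd_pairs :: "nat set \<Rightarrow> (nat \<times> nat) set" where
  "fwd_pairs V = {(u, v). u \<in> V \<and> v \<in> V \<and> u < v}"

text \<open>For sets of forward pairs \<open>a < b < c < d\<close> is automatic. The excluded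
  pattern is a special shortcut in the sense of semi-transitive orientations; \<open>(b, d)\<close>
  may be present or absent.\<close>

definition shortcut_free :: "(nat \<times> nat) set \<Rightarrow> bool" where
  "shortcut_free A \<longleftrightarrow> (\<forall>a b c d. (a, b) \<in> A \<longrightarrow> (b, c) \<in> A \<longrightarrow> (c, d) \<in> A \<longrightarrow> (a, d) \<in> A \<longrightarrow> (a, c) \<in> A)"

lemma fwd_pairs_subset: "fwd_pairs V \<subseteq> V \<times> V"
  by (auto simp: fwd_pairs_def)

lemma finite_fwd_pairs: "finite V \<Longrightarrow> finite (fwd_pairs V)"
  by (rule finite_subset[OF fwd_pairs_subset]) simp

lemma sum4_of_bool:
  assumes "finite V"
  shows "(\<Sum>a\<in>V. \<Sum>b\<in>V. \<Sum>c\<in>V. \<Sum>d\<in>V. of_bool (P a b c d) :: real)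
    = card {(a, b, c, d). a \<in> V \<and> b \<in> V \<and> c \<in> V \<and> d \<in> V \<and> P a b c d}"
proof -
  have "(\<Sum>a\<in>V. \<Sum>b\<in>V. \<Sum>c\<in>V. \<Sum>d\<in>V. of_bool (P a b c d) :: real)
    = (\<Sum>(a, b, c, d)\<in>V \<times> V \<times> V \<times> V. of_bool (P a b c d))"
    by (simp add: sum.cartesian_product)
  also have "\<dots> = (\<Sum>x\<in>V \<times> V \<times> V \<times> V. of_bool (case x of (a, b, c, d) \<Rightarrow> P a b c d))"
    by (intro sum.cong) auto
  also have "\<dots> = card ((V \<times> V \<times> V \<times> V) \<inter> {x. case x of (a, b, c, d) \<Rightarrow> P a b c d})"
    using assms by simp
  also have "(V \<times> V \<times> V \<times> V) \<inter> {x. case x of (a, b, c, d) \<Rightarrow> P a b c d}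
    = {(a, b, c, d). a \<in> V \<and> b \<in> V \<and> c \<in> V \<and> d \<in> V \<and> P a b c d}" by auto
  finally show ?thesis .
qed

lemma card_4_sorted:
  fixes S :: "'a::linorder set"
  assumes "card S = 4"
  obtains a b c d where "S = {a, b, c, d}" "a < b" "b < c" "c < d"
proof -
  have fin: "finite S" using assms by (intro card_ge_0_finite) simp
  have "\<exists>a b c d. xs = [a, b, c, d]" if "length xs = 4" for xs :: "'a list"
    using that by (auto simp: numeral_eq_Suc length_Suc_conv)
  then obtain a b c d where l: "sorted_list_of_set S = [a, b, c, d]"
    using assms by (metis length_sorted_list_of_set)
  have "sorted_wrt (<) (sorted_list_of_set S)" by simp
  then have "a < b" "b < c" "c < d" unfolding l by auto
  moreover have "S = {a, b, c, d}" using set_sorted_list_of_set[OF fin] l by auto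
  ultimately show ?thesis using that by blast
qed

text \<open>Sorting the vertices of a clique gives a quadruple on the right, and a sorted quadruple
  accounts for at most 4^4 = 256 tuples with entries among its members.\<close>

lemma card_K4_le:
  fixes \<Gamma> :: "(nat \<times> nat) set"
  assumes fin: "finite V" and \<Gamma>: "\<Gamma> \<subseteq> fwd_pairs V" and adj: "\<And>u v. adj u v \<longleftrightarrow> (u, v) \<in> \<Gamma> \<or> (v, u) \<in> \<Gamma>"
  shows "card {(a, b, c, d). a \<in> V \<and> b \<in> V \<and> c \<in> V \<and> d \<in> V \<and>
      adj a b \<and> adj b c \<and> adj a c \<and> adj a d \<and> adj b d \<and> adj c d}
    \<le> 256 * card {(a, b, c, d). a \<in> V \<and> b \<in> V \<and> c \<in> V \<and> d \<in> V \<and>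
      (a, b) \<in> \<Gamma> \<and> (b, c) \<in> \<Gamma> \<and> (c, d) \<in> \<Gamma> \<and> (a, d) \<in> \<Gamma> \<and> (a, c) \<in> \<Gamma>}" (is "card ?H \<le> 256 * card ?I")
proof -
  define Q where "Q t = (case t of (a, b, c, d) \<Rightarrow> {a, b, c, d} \<times> {a, b, c, d} \<times> {a, b, c, d} \<times> {a, b, c, d})"
    for t :: "nat \<times> nat \<times> nat \<times> nat"
  have finI: "finite ?I" by (rule finite_subset[of _ "V \<times> V \<times> V \<times> V"]) (use fin in auto)
  have finQ: "finite (Q t)" for t
    by (cases t) (simp only: Q_def prod.case finite_cartesian_product finite.intros)
  have lt: "u < v" if "(u, v) \<in> \<Gamma>" for u v using that \<Gamma> by (auto simp: fwd_pairs_def)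
  have "?H \<subseteq> (\<Union>t\<in>?I. Q t)"
  proof safe
    fix x y z w assume V: "x \<in> V" "y \<in> V" "z \<in> V" "w \<in> V"
      and H: "adj x y" "adj y z" "adj x z" "adj x w" "adj y w" "adj z w"
    have irr: "\<not> adj u u" for u using adj lt by blast
    have comm: "adj v u" if "adj u v" for u v using that adj by blast
    have "card {x, y, z, w} = 4" using H irr by (auto simp: card_insert_if)
    then obtain a b c d where S: "{x, y, z, w} = {a, b, c, d}" "a < b" "b < c" "c < d"
      by (rule card_4_sorted)
    have \<Gamma>I: "(u, v) \<in> \<Gamma>" if "u < v" "u \<in> {x, y, z, w}" "v \<in> {x, y, z, w}" for u v
    proof -
      have "adj u v" using that H comm by auto
      then show ?thesis using adj lt that(1) less_asym by blast
    qed
    have "a < c" "a < d" using S by auto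
    moreover have "{a, b, c, d} \<subseteq> V" unfolding S(1)[symmetric] using V by simp
    moreover have "a \<in> {x, y, z, w}" "b \<in> {x, y, z, w}" "c \<in> {x, y, z, w}" "d \<in> {x, y, z, w}"
      unfolding S(1) by simp_all
    ultimately have "(a, b, c, d) \<in> ?I" using S(2-4) \<Gamma>I by simp
    moreover have "x \<in> {a, b, c, d}" "y \<in> {a, b, c, d}" "z \<in> {a, b, c, d}" "w \<in> {a, b, c, d}"
      unfolding S(1)[symmetric] by simp_all
    then have "(x, y, z, w) \<in> Q (a, b, c, d)"
      unfolding Q_def prod.case by (intro SigmaI)
    ultimately show "(x, y, z, w) \<in> (\<Union>t\<in>?I. Q t)" by blast
  qed
  then have "card ?H \<le> card (\<Union>t\<in>?I. Q t)"
    by (intro card_mono finite_UN_I finI finQ)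
  also have "\<dots> \<le> (\<Sum>t\<in>?I. card (Q t))" by (rule card_UN_le[OF finI])
  also have "\<dots> \<le> (\<Sum>t\<in>?I. 256)"
  proof (rule sum_mono)
    fix t :: "nat \<times> nat \<times> nat \<times> nat"
    obtain a b c d where t: "t = (a, b, c, d)" by (cases t)
    have "card {a, b, c, d} \<le> 4" by (auto simp: card_insert_if)
    then have "card {a, b, c, d} * (card {a, b, c, d} * (card {a, b, c, d} * card {a, b, c, d})) \<le> 4 * (4 * (4 * 4))"
      by (intro mult_mono) auto
    then show "card (Q t) \<le> 256" unfolding Q_def t prod.case card_cartesian_product by linarith
  qed
  finally show ?thesis by (simp add: mult.commute)
qed

text \<open>\<open>L\<close> collects the cells where edges have density below
  \<open>\<eta>\<close>, \<open>U\<close> those where non-edges do, so both exceptional sets are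
  small. Were the remaining pairs too many, supersaturation would give
  \<open>\<gamma> * n ^ 4 / 256\<close> sorted quadruples, each of averaged weight at least
  \<open>\<eta> ^ 5\<close>, against a true count of zero.\<close>

lemma gray_template:
  assumes fin: "finite V" and A: "A \<subseteq> fwd_pairs V" and free: "shortcut_free A"
    and \<eta>: "\<eta> > 0" and \<gamma>: "\<gamma> > 0" and K: "real K * (\<eta> ^ 5 * \<gamma> / 2000)\<^sup>2 > 2"
  obtains p :: "nat \<Rightarrow> nat" and L U where "p \<in> V \<rightarrow> {..<4 ^ K}" "L \<subseteq> {..<4 ^ K} \<times> {..<4 ^ K}" "U \<subseteq> {..<4 ^ K} \<times> {..<4 ^ K}"
    "real (card {x \<in> A. map_prod p p x \<in> L}) \<le> \<eta> * (real (card V))\<^sup>2"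
    "real (card {x \<in> fwd_pairs V - A. map_prod p p x \<in> U}) \<le> \<eta> * (real (card V))\<^sup>2"
    "real (card {x \<in> fwd_pairs V. map_prod p p x \<notin> L \<union> U}) \<le> (1 / 3 + \<gamma>) * (real (card V))\<^sup>2"
proof -
  define n where "n = real (card V)"
  \<comment> \<open>Five cut-norm errors cost
    \<open>5 * \<epsilon> = \<eta> ^ 5 * \<gamma> / 400\<close>, strictly below the weight
    \<open>\<eta> ^ 5 * \<gamma> / 256\<close>, both per \<open>n ^ 4\<close>.\<close>
  define \<epsilon> where "\<epsilon> = \<eta> ^ 5 * \<gamma> / 2000"
  have \<epsilon>: "\<epsilon> > 0" using \<eta> \<gamma> by (simp add: \<epsilon>_def)
  define B where "B = fwd_pairs V - A"
  have AB: "A \<subseteq> V \<times> V" "B \<subseteq> V \<times> V" using A fwd_pairs_subset by (auto simp: B_def)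
  define M where "M X x = (of_bool (x \<in> X) :: real)" for X and x :: "nat \<times> nat"
  have M01: "0 \<le> M X x \<and> M X x \<le> 1" for X x by (auto simp: M_def)
  have "real (card {A, B}) \<le> 2" by (simp add: card_insert_if)
  then have K': "real (card {A, B}) < real K * \<epsilon>\<^sup>2" using K unfolding \<epsilon>_def by linarith
  have "\<exists>p. p \<in> V \<rightarrow> {..<4 ^ K} \<and> (\<forall>X\<in>{A, B}. cut_regular V p \<epsilon> (M X))"
  proof (rule weak_regularity[where V = V and I = "{A, B}" and \<epsilon> = \<epsilon> and K = K and f = M])
    show "0 \<le> M X x \<and> M X x \<le> 1" for X x by (rule M01)
  qed (use fin \<epsilon> K' in blast)+
  then obtain p where p: "p \<in> V \<rightarrow> {..<4 ^ K}" and reg: "\<And>X. X \<in> {A, B} \<Longrightarrow> cut_regular V p \<epsilon> (M X)"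
    by blast
  let ?q = "map_prod p p" and ?X = "V \<times> V"
  define W where "W X = cell_avg ?X ?q (M X)" for X
  have W01: "0 \<le> W X x \<and> W X x \<le> 1" for X x
    using M01 by (auto simp: W_def intro!: cell_avg_nonneg cell_avg_le_1)
  have finX: "finite ?X" using fin by simp
  define low where "low X = ?q ` {x \<in> ?X. W X x < \<eta>}" for X
  have low_iff: "?q x \<in> low X \<longleftrightarrow> W X x < \<eta>" if "x \<in> ?X" for x X
    unfolding low_def W_def using that cell_avg_cong[of ?q x _ ?X "M X"] by (smt (verit) image_iff mem_Collect_eq)
  \<comment> \<open>Averaging preserves the mass of \<open>X\<close> on any union of cells exactly,
    so this bound carries no regularity error.\<close>
  have card_low: "real (card {x \<in> X. ?q x \<in> low X}) \<le> \<eta> * n\<^sup>2" if "X \<subseteq> ?X" for X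
  proof -
    have "real (card {x \<in> X. ?q x \<in> low X}) = (\<Sum>x\<in>?X. of_bool (x \<in> {x \<in> X. ?q x \<in> low X}))"
      using finX that by (simp add: Int_absorb1 subset_eq)
    also have "\<dots> = (\<Sum>x\<in>?X. M X x * of_bool (?q x \<in> low X))"
      by (rule sum.cong) (auto simp: M_def)
    also have "\<dots> = (\<Sum>x\<in>?X. W X x * of_bool (?q x \<in> low X))"
      unfolding W_def by (rule sum_cell_avg_mult[OF finX, symmetric])
    also have "\<dots> \<le> (\<Sum>x\<in>?X. \<eta>)"
      by (rule sum_mono) (use \<eta> in \<open>auto simp: low_iff\<close>)
    finally show ?thesis by (simp add: card_cartesian_product n_def power2_eq_square mult_ac)
  qed
  define \<Gamma> where "\<Gamma> = {x \<in> fwd_pairs V. ?q x \<notin> low A \<union> low B}"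
  have \<Gamma>_W: "\<eta> \<le> W A x" "\<eta> \<le> W B x" if "x \<in> \<Gamma>" for x
    using that low_iff[of x] fwd_pairs_subset[of V] by (auto simp: \<Gamma>_def not_less)
  have "real (card \<Gamma>) \<le> (1 / 3 + \<gamma>) * n\<^sup>2"
  proof (rule ccontr)
    assume "\<not> ?thesis"
    then have big: "real (card \<Gamma>) > (1 / 3 + \<gamma>) * n\<^sup>2" by simp
    have n: "n > 0"
    proof (rule ccontr)
      assume "\<not> n > 0"
      then have "V = {}" using fin by (simp add: n_def)
      then show False using big by (simp add: \<Gamma>_def fwd_pairs_def n_def)
    qed
    have \<Gamma>_sub: "\<Gamma> \<subseteq> fwd_pairs V" by (auto simp: \<Gamma>_def)
    have fin\<Gamma>: "finite \<Gamma>" using \<Gamma>_sub finite_fwd_pairs[OF fin] by (rule finite_subset)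
    \<comment> \<open>\<open>K4_supersaturation\<close> takes a symmetric kernel, so every forward
      pair counts twice and the threshold 1/3 becomes 2/3.\<close>
    define adj where "adj u v \<longleftrightarrow> (u, v) \<in> \<Gamma> \<or> (v, u) \<in> \<Gamma>" for u v
    define g where "g u v = (of_bool (adj u v) :: real)" for u v
    have "(\<Sum>u\<in>V. \<Sum>v\<in>V. g u v) = (\<Sum>x\<in>?X. of_bool (x \<in> \<Gamma> \<union> \<Gamma>\<inverse>))"
      unfolding sum.cartesian_product by (rule sum.cong) (auto simp: g_def adj_def)
    also have "\<dots> = card (\<Gamma> \<union> \<Gamma>\<inverse>)"
      using finX \<Gamma>_sub fwd_pairs_subset[of V] by (subst sum_of_bool_eq) (auto intro!: arg_cong[of _ _ card])
    also have "\<dots> = card \<Gamma> + card (\<Gamma>\<inverse>)"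
    proof -
      have "u < v" if "(u, v) \<in> \<Gamma>" for u v using that \<Gamma>_sub by (auto simp: fwd_pairs_def)
      then have "(v, u) \<notin> \<Gamma>" if "(u, v) \<in> \<Gamma>" for u v using that less_asym by blast
      then have "\<Gamma> \<inter> \<Gamma>\<inverse> = {}" by auto
      then show ?thesis using fin\<Gamma> by (simp add: card_Un_disjoint)
    qed
    also have "\<dots> = 2 * card \<Gamma>" by (simp add: card_inverse)
    finally have "(2 / 3 + 2 * \<gamma>) * (real (card V))\<^sup>2 \<le> (\<Sum>u\<in>V. \<Sum>v\<in>V. g u v)"
      using big by (simp add: n_def algebra_simps)
    then have "\<gamma> * real (card V) ^ 4
      \<le> (\<Sum>a\<in>V. \<Sum>b\<in>V. \<Sum>c\<in>V. \<Sum>d\<in>V. g a b * g b c * g a c * (g a d * g b d * g c d))"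
      using \<gamma> by (intro K4_supersaturation fin) (auto simp: g_def adj_def)
    also have "\<dots> = (\<Sum>a\<in>V. \<Sum>b\<in>V. \<Sum>c\<in>V. \<Sum>d\<in>V.
        of_bool (adj a b \<and> adj b c \<and> adj a c \<and> adj a d \<and> adj b d \<and> adj c d))"
      by (intro sum.cong refl) (simp add: g_def)
    also have "\<dots> \<le> 256 * real (card {(a, b, c, d). a \<in> V \<and> b \<in> V \<and> c \<in> V \<and> d \<in> V \<and>
      (a, b) \<in> \<Gamma> \<and> (b, c) \<in> \<Gamma> \<and> (c, d) \<in> \<Gamma> \<and> (a, d) \<in> \<Gamma> \<and> (a, c) \<in> \<Gamma>})"
      unfolding sum4_of_bool[OF fin] using card_K4_le[OF fin \<Gamma>_sub adj_def] by linarith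
    finally have many: "\<gamma> * n ^ 4 / 256 \<le> (\<Sum>a\<in>V. \<Sum>b\<in>V. \<Sum>c\<in>V. \<Sum>d\<in>V.
        of_bool ((a, b) \<in> \<Gamma> \<and> (b, c) \<in> \<Gamma> \<and> (c, d) \<in> \<Gamma> \<and> (a, d) \<in> \<Gamma> \<and> (a, c) \<in> \<Gamma>))"
      unfolding sum4_of_bool[OF fin] by (simp add: n_def)
    have "\<eta> ^ 5 * (\<gamma> * n ^ 4 / 256) \<le> (\<Sum>a\<in>V. \<Sum>b\<in>V. \<Sum>c\<in>V. \<Sum>d\<in>V. \<eta> ^ 5 *
        of_bool ((a, b) \<in> \<Gamma> \<and> (b, c) \<in> \<Gamma> \<and> (c, d) \<in> \<Gamma> \<and> (a, d) \<in> \<Gamma> \<and> (a, c) \<in> \<Gamma>))"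
      unfolding sum_distrib_left[symmetric] using many \<eta> by (intro mult_left_mono) auto
    also have "\<dots> \<le> (\<Sum>a\<in>V. \<Sum>b\<in>V. \<Sum>c\<in>V. \<Sum>d\<in>V. W A (a, b) * W A (b, c) * W A (c, d) * W A (a, d) * W B (a, c))"
    proof (intro sum_mono)
      fix a b c d
      show "\<eta> ^ 5 * of_bool ((a, b) \<in> \<Gamma> \<and> (b, c) \<in> \<Gamma> \<and> (c, d) \<in> \<Gamma> \<and> (a, d) \<in> \<Gamma> \<and> (a, c) \<in> \<Gamma>)
        \<le> W A (a, b) * W A (b, c) * W A (c, d) * W A (a, d) * W B (a, c)"
        (is "_ * of_bool ?P \<le> ?w")
      proof (cases ?P)
        case True
        then have "\<eta> * \<eta> * \<eta> * \<eta> * \<eta> \<le> ?w"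
          using \<eta> W01 by (intro mult_mono \<Gamma>_W) auto
        moreover have "\<eta> ^ 5 = \<eta> * \<eta> * \<eta> * \<eta> * \<eta>" by (simp add: power_numeral_reduce)
        ultimately show ?thesis by (simp only: True simp_thms of_bool_eq mult_1_right)
      next
        case False
        have "0 \<le> ?w" by (intro mult_nonneg_nonneg) (use W01 in blast)+
        then show ?thesis by (simp only: False of_bool_eq mult_zero_right)
      qed
    qed
    also have "\<dots> \<le> (\<Sum>a\<in>V. \<Sum>b\<in>V. \<Sum>c\<in>V. \<Sum>d\<in>V. M A (a, b) * M A (b, c) * M A (c, d) * M A (a, d) * M B (a, c))
      + 5 * \<epsilon> * real (card V) ^ 4"
    proof (intro counting_lemma fin)
      fix S T assume ST: "S \<subseteq> V" "T \<subseteq> V"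
      have "\<bar>\<Sum>x\<in>S \<times> T. W X x - M X x\<bar> \<le> \<epsilon> * (real (card V))\<^sup>2" if "X \<in> {A, B}" for X
        using reg[OF that] ST unfolding cut_regular_def W_def sum_subtractf
        by (subst abs_minus_commute) blast
      then show "\<bar>\<Sum>x\<in>S \<times> T. W A x - M A x\<bar> \<le> \<epsilon> * (real (card V))\<^sup>2"
        "\<bar>\<Sum>x\<in>S \<times> T. W B x - M B x\<bar> \<le> \<epsilon> * (real (card V))\<^sup>2"
        by blast+
    qed (use M01 W01 in blast)+
    \<comment> \<open>A nonzero term would be a quadruple with four pairs in \<open>A\<close> and
      \<open>(a, c)\<close> in \<open>B\<close>, against \<open>shortcut_free A\<close>.\<close>
    also have "(\<Sum>a\<in>V. \<Sum>b\<in>V. \<Sum>c\<in>V. \<Sum>d\<in>V. M A (a, b) * M A (b, c) * M A (c, d) * M A (a, d) * M B (a, c)) = 0"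
    proof (intro sum.neutral ballI)
      fix a b c d
      have "(a, b) \<notin> A \<or> (b, c) \<notin> A \<or> (c, d) \<notin> A \<or> (a, d) \<notin> A \<or> (a, c) \<notin> B"
        using free unfolding shortcut_free_def B_def by blast
      then show "M A (a, b) * M A (b, c) * M A (c, d) * M A (a, d) * M B (a, c) = 0"
        unfolding M_def by (elim disjE) simp_all
    qed
    finally have "\<eta> ^ 5 * (\<gamma> * n ^ 4 / 256) \<le> 0 + 5 * (\<eta> ^ 5 * \<gamma> / 2000) * n ^ 4"
      unfolding \<epsilon>_def n_def .
    then have "\<eta> ^ 5 * \<gamma> * n ^ 4 / 256 \<le> \<eta> ^ 5 * \<gamma> * n ^ 4 / 400" by (simp add: mult_ac)
    moreover have "\<eta> ^ 5 * \<gamma> * n ^ 4 > 0" using \<eta> \<gamma> n by simp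
    ultimately show False by linarith
  qed
  moreover have "low X \<subseteq> {..<4 ^ K} \<times> {..<4 ^ K}" for X using p by (auto simp: low_def)
  ultimately show ?thesis
    using that[of p "low A" "low B"] p card_low[OF AB(1)] card_low[OF AB(2)]
    by (simp add: n_def \<Gamma>_def B_def)
qed

section \<open>Counting shortcut-free sets through templates\<close>

lemma sum_power_card_Pow:
  fixes x :: "'a::comm_semiring_1"
  assumes "finite X"
  shows "(\<Sum>S\<in>Pow X. x ^ card S) = (1 + x) ^ card X"
  using assms
proof (induction X)
  case empty
  then show ?case by simp
next
  case (insert a X)
  have inj: "inj_on (insert a) (Pow X)" using insert.hyps by (auto simp: inj_on_def)
  have "(\<Sum>S\<in>Pow (insert a X). x ^ card S) = (\<Sum>S\<in>Pow X. x ^ card S) + (\<Sum>S\<in>insert a ` Pow X. x ^ card S)"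
    unfolding Pow_insert by (rule sum.union_disjoint) (use insert.hyps in auto)
  also have "(\<Sum>S\<in>insert a ` Pow X. x ^ card S) = (\<Sum>S\<in>Pow X. x * x ^ card S)"
    unfolding sum.reindex[OF inj] o_def
  proof (rule sum.cong[OF refl])
    fix S assume "S \<in> Pow X"
    then have "a \<notin> S" "finite S" using insert.hyps finite_subset by auto
    then show "x ^ card (insert a S) = x * x ^ card S" by simp
  qed
  finally show ?case
    using insert by (simp add: distrib_right flip: sum_distrib_left)
qed

text \<open>Rankin's trick: a set of size at most \<open>t\<close> has weight
  \<open>x ^ card S * (1 / x) powr t\<close> at least 1, and the weights of all subsets sum to a
  binomial power.\<close>

lemma card_small_subsets_le:
  fixes x t :: real
  assumes "finite X" "0 < x" "x \<le> 1"
  shows "real (card {S. S \<subseteq> X \<and> real (card S) \<le> t}) \<le> (1 + x) ^ card X * (1 / x) powr t"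
proof -
  have "real (card {S. S \<subseteq> X \<and> real (card S) \<le> t}) = (\<Sum>S | S \<subseteq> X \<and> real (card S) \<le> t. 1)"
    by simp
  also have "\<dots> \<le> (\<Sum>S | S \<subseteq> X \<and> real (card S) \<le> t. x ^ card S * (1 / x) powr t)"
  proof (rule sum_mono)
    fix S assume "S \<in> {S. S \<subseteq> X \<and> real (card S) \<le> t}"
    then have "(1 / x) powr real (card S) \<le> (1 / x) powr t"
      using assms by (intro powr_mono) auto
    then have "x ^ card S * (1 / x) ^ card S \<le> x ^ card S * (1 / x) powr t"
      using assms by (intro mult_left_mono) (auto simp: powr_realpow)
    then show "1 \<le> x ^ card S * (1 / x) powr t"
      using assms by (simp add: power_mult_distrib[symmetric])
  qed
  also have "\<dots> \<le> (\<Sum>S\<in>Pow X. x ^ card S * (1 / x) powr t)"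
    by (rule sum_mono2) (use assms in auto)
  also have "\<dots> = (1 + x) ^ card X * (1 / x) powr t"
    unfolding sum_distrib_right[symmetric] sum_power_card_Pow[OF assms(1)] ..
  finally show ?thesis .
qed

text \<open>A set is recovered from a template, two small correction sets and an arbitrary part on
  the gray pairs. Only the gray part costs about n^2/3 bits; the corrections cost a multiple of n^2
  that suitable \<open>x\<close> and \<open>\<eta>\<close> make arbitrarily small.\<close>

lemma card_shortcut_free_le:
  fixes \<eta> \<gamma> x :: real
  assumes fin: "finite V" and \<eta>: "\<eta> > 0" and \<gamma>: "\<gamma> > 0" and K: "real K * (\<eta> ^ 5 * \<gamma> / 2000)\<^sup>2 > 2"
    and x: "0 < x" "x \<le> 1"
  defines "n \<equiv> real (card V)"
  shows "real (card {A. A \<subseteq> fwd_pairs V \<and> shortcut_free A})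
    \<le> (4 ^ K) ^ card V * (2 ^ (4 ^ K * 4 ^ K)) ^ 2
      * (((1 + x) ^ (card V * card V) * (1 / x) powr (\<eta> * n\<^sup>2)) ^ 2 * 2 powr ((1 / 3 + \<gamma>) * n\<^sup>2))"
proof -
  let ?k = "4 ^ K :: nat" and ?P = "fwd_pairs V"
  let ?C = "{..<?k} \<times> {..<?k}"
  have finP: "finite ?P" by (rule finite_fwd_pairs[OF fin])
  define small where "small = {S. S \<subseteq> ?P \<and> real (card S) \<le> \<eta> * n\<^sup>2}"
  have fin_small: "finite small" using finP by (simp add: small_def)
  define gray where "gray = (\<lambda>(p :: nat \<Rightarrow> nat, L, U). {x \<in> ?P. map_prod p p x \<notin> L \<union> U})"
  define I where "I = {i \<in> (V \<rightarrow>\<^sub>E {..<?k}) \<times> Pow ?C \<times> Pow ?C. real (card (gray i)) \<le> (1 / 3 + \<gamma>) * n\<^sup>2}"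
  \<comment> \<open>Cells of \<open>L\<close> default to non-edges and cells of \<open>U - L\<close>
    to edges; \<open>X\<close> and \<open>Y\<close> hold the exceptions, \<open>Z\<close> the gray
    edges. Averages also run over backward pairs, so a cell can lie in both \<open>L\<close> and
    \<open>U\<close>, and then \<open>L\<close> decides.\<close>
  define dec where "dec = (\<lambda>(p :: nat \<Rightarrow> nat, L, U) (X, Y, Z). X \<union> ({x \<in> ?P. map_prod p p x \<in> U - L} - Y) \<union> Z)"
  define fam where "fam i = dec i ` (small \<times> small \<times> Pow (gray i))" for i
  have finI0: "finite ((V \<rightarrow>\<^sub>E {..<?k}) \<times> Pow ?C \<times> Pow ?C)" using fin by (intro finite_cartesian_product finite_PiE) auto
  then have finI: "finite I" by (simp add: I_def)
  have fin_gray: "finite (gray i)" for i using finP by (cases i) (simp add: gray_def)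
  have cover: "{A. A \<subseteq> ?P \<and> shortcut_free A} \<subseteq> (\<Union>i\<in>I. fam i)"
  proof
    fix A assume "A \<in> {A. A \<subseteq> ?P \<and> shortcut_free A}"
    then have A: "A \<subseteq> ?P" "shortcut_free A" by auto
    obtain p L U where pLU: "p \<in> V \<rightarrow> {..<?k}" "L \<subseteq> ?C" "U \<subseteq> ?C"
      "real (card {x \<in> A. map_prod p p x \<in> L}) \<le> \<eta> * n\<^sup>2"
      "real (card {x \<in> ?P - A. map_prod p p x \<in> U}) \<le> \<eta> * n\<^sup>2"
      "real (card {x \<in> ?P. map_prod p p x \<notin> L \<union> U}) \<le> (1 / 3 + \<gamma>) * n\<^sup>2"
      by (rule gray_template[OF fin A \<eta> \<gamma> K, folded n_def])
    \<comment> \<open>Cutting \<open>p\<close> off outside \<open>V\<close> puts it into the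
      extensional function space, in which the labellings are counted.\<close>
    define r where "r = restrict p V"
    have r: "map_prod r r x = map_prod p p x" if "x \<in> ?P" for x
      using that by (auto simp: r_def fwd_pairs_def)
    have sets: "{x \<in> A. map_prod r r x \<in> L} = {x \<in> A. map_prod p p x \<in> L}"
      "{x \<in> ?P - A. map_prod r r x \<in> U} = {x \<in> ?P - A. map_prod p p x \<in> U}"
      "{x \<in> ?P. map_prod r r x \<notin> L \<union> U} = {x \<in> ?P. map_prod p p x \<notin> L \<union> U}"
    proof -
      have r': "map_prod r r x = map_prod p p x" if "x \<in> A" for x using r A(1) that by blast
      show "{x \<in> A. map_prod r r x \<in> L} = {x \<in> A. map_prod p p x \<in> L}"
        by (rule Collect_cong, rule conj_cong[OF refl], simp only: r')
      show "{x \<in> ?P - A. map_prod r r x \<in> U} = {x \<in> ?P - A. map_prod p p x \<in> U}"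
        "{x \<in> ?P. map_prod r r x \<notin> L \<union> U} = {x \<in> ?P. map_prod p p x \<notin> L \<union> U}"
        by (rule Collect_cong, rule conj_cong[OF refl], simp only: r DiffD1)+
    qed
    have "(r, L, U) \<in> I"
      unfolding I_def gray_def mem_Collect_eq prod.case sets(3)
      using pLU by (auto simp: r_def Pi_iff)
    moreover have "A = dec (r, L, U) ({x \<in> A. map_prod r r x \<in> L}, {x \<in> ?P - A. map_prod r r x \<in> U},
        {x \<in> A. map_prod r r x \<notin> L \<union> U})"
      using A(1) unfolding dec_def by auto
    moreover have "{x \<in> A. map_prod r r x \<in> L} \<in> small" "{x \<in> ?P - A. map_prod r r x \<in> U} \<in> small"
      unfolding small_def sets using pLU(4,5) A(1) by auto
    moreover have "{x \<in> A. map_prod r r x \<notin> L \<union> U} \<in> Pow (gray (r, L, U))"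
      using A(1) by (auto simp: gray_def)
    ultimately show "A \<in> (\<Union>i\<in>I. fam i)" unfolding fam_def by blast
  qed
  let ?s = "(1 + x) ^ (card V * card V) * (1 / x) powr (\<eta> * n\<^sup>2)"
  have "card ?P \<le> card V * card V"
    using card_mono[OF _ fwd_pairs_subset, of V] fin by (simp add: card_cartesian_product)
  then have "(1 + x) ^ card ?P \<le> (1 + x) ^ (card V * card V)" using x by (intro power_increasing) auto
  then have s: "real (card small) \<le> ?s"
    using card_small_subsets_le[OF finP x, of "\<eta> * n\<^sup>2"] unfolding small_def
    by (meson mult_right_mono order_trans powr_ge_zero)
  have fam: "real (card (fam i)) \<le> ?s ^ 2 * 2 powr ((1 / 3 + \<gamma>) * n\<^sup>2)" if "i \<in> I" for i
  proof -
    have "card (fam i) \<le> card (small \<times> small \<times> Pow (gray i))"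
      unfolding fam_def using fin_small fin_gray by (intro card_image_le) auto
    also have "\<dots> = card small * card small * 2 ^ card (gray i)"
      using fin_gray by (simp add: card_cartesian_product card_Pow)
    finally have "real (card (fam i)) \<le> real (card small * card small * 2 ^ card (gray i))"
      by (simp only: of_nat_le_iff)
    also have "\<dots> = real (card small) * real (card small) * 2 powr real (card (gray i))"
      by (simp add: powr_realpow)
    also have "\<dots> \<le> ?s * ?s * 2 powr ((1 / 3 + \<gamma>) * n\<^sup>2)"
      using s that x by (intro mult_mono powr_mono) (auto simp: I_def)
    finally show ?thesis by (simp only: power2_eq_square)
  qed
  have "card I \<le> card ((V \<rightarrow>\<^sub>E {..<?k}) \<times> Pow ?C \<times> Pow ?C)"
    by (rule card_mono[OF finI0]) (auto simp: I_def)
  also have "\<dots> = ?k ^ card V * (2 ^ (?k * ?k)) ^ 2"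
    using fin by (simp add: card_cartesian_product card_funcsetE card_Pow power2_eq_square)
  finally have cI: "real (card I) \<le> real (?k ^ card V * (2 ^ (?k * ?k)) ^ 2)"
    by (simp only: of_nat_le_iff)
  have "card {A. A \<subseteq> ?P \<and> shortcut_free A} \<le> card (\<Union>i\<in>I. fam i)"
    using fin_small fin_gray finI by (intro card_mono cover) (auto simp: fam_def)
  also have "\<dots> \<le> (\<Sum>i\<in>I. card (fam i))" by (rule card_UN_le[OF finI])
  finally have "real (card {A. A \<subseteq> ?P \<and> shortcut_free A}) \<le> (\<Sum>i\<in>I. real (card (fam i)))"
    by (simp only: of_nat_le_iff flip: of_nat_sum)
  also have "\<dots> \<le> (\<Sum>i\<in>I. ?s ^ 2 * 2 powr ((1 / 3 + \<gamma>) * n\<^sup>2))" by (rule sum_mono[OF fam])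
  also have "\<dots> = real (card I) * (?s ^ 2 * 2 powr ((1 / 3 + \<gamma>) * n\<^sup>2))" by simp
  also have "\<dots> \<le> real (?k ^ card V * (2 ^ (?k * ?k)) ^ 2) * (?s ^ 2 * 2 powr ((1 / 3 + \<gamma>) * n\<^sup>2))"
    by (rule mult_right_mono[OF cI]) simp
  finally show ?thesis by simp
qed

section \<open>Alternation and prefix counts\<close>

lemma alternating_word_Suc:
  "alternating_word x y (Suc k) = alternating_word x y k @ [if even k then x else y]"
  by (simp add: alternating_word_def)

lemma count_list_alternating_word:
  assumes "x \<noteq> y"
  shows "count_list (alternating_word x y k) x = (k + 1) div 2"
    "count_list (alternating_word x y k) y = k div 2"
  using assms by (induction k) (auto simp: alternating_word_Suc, simp_all add: alternating_word_def)

lemma count_list_filter_pair: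
  "z = x \<or> z = y \<Longrightarrow> count_list (filter (\<lambda>z. z = x \<or> z = y) w) z = count_list w z"
  by (induction w) auto

text \<open>After \<open>k\<close> letters of an alternating word the counts are
  \<open>(k + 1) div 2\<close> and \<open>k div 2\<close>, so a wrong next letter leaves the band at
  once. Induction on the last letter therefore matches both sides.\<close>

lemma alternating_word_iff_counts:
  assumes "x \<noteq> y"
  shows "(\<exists>k. filter (\<lambda>z. z = x \<or> z = y) w = alternating_word x y k) \<longleftrightarrow>
    (\<forall>i. count_list (take i w) y \<le> count_list (take i w) x \<and>
         count_list (take i w) x \<le> count_list (take i w) y + 1)"
proof (induction w rule: rev_induct)
  case Nil
  show ?case by (auto simp: alternating_word_def intro!: exI[of _ 0])
next
  case (snoc a w)
  let ?F = "filter (\<lambda>z. z = x \<or> z = y)"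
  let ?P = "\<lambda>u. count_list u y \<le> count_list u x \<and> count_list u x \<le> count_list u y + 1"
  have takes: "(\<forall>i. ?P (take i (w @ [a]))) \<longleftrightarrow> (\<forall>i. ?P (take i w)) \<and> ?P (w @ [a])"
  proof (intro iffI conjI allI)
    fix i assume *: "\<forall>i. ?P (take i (w @ [a]))"
    have "take i w = take (min i (length w)) (w @ [a])" by (simp add: min_def)
    then show "count_list (take i w) y \<le> count_list (take i w) x"
      "count_list (take i w) x \<le> count_list (take i w) y + 1" using * by presburger+
  next
    assume "\<forall>i. ?P (take i (w @ [a]))"
    then have "?P (take (Suc (length w)) (w @ [a]))" by blast
    then show "count_list (w @ [a]) y \<le> count_list (w @ [a]) x"
      "count_list (w @ [a]) x \<le> count_list (w @ [a]) y + 1" by auto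
  next
    fix i assume "(\<forall>i. ?P (take i w)) \<and> ?P (w @ [a])"
    then have "?P (take i (w @ [a]))" by (cases "i \<le> length w") auto
    then show "count_list (take i (w @ [a])) y \<le> count_list (take i (w @ [a])) x"
      "count_list (take i (w @ [a])) x \<le> count_list (take i (w @ [a])) y + 1" by auto
  qed
  have counts: "count_list w x = (k + 1) div 2" "count_list w y = k div 2"
    if "?F w = alternating_word x y k" for k
    using count_list_alternating_word[OF assms, of k] count_list_filter_pair[of x x y w]
      count_list_filter_pair[of y x y w] that by auto
  show ?case
  proof (cases "a = x \<or> a = y")
    case False
    moreover have "?P w" if "\<forall>i. ?P (take i w)"
      using that[rule_format, of "length w"] by simp
    ultimately show ?thesis unfolding takes snoc.IH[symmetric] by (auto simp: snoc.IH)
  next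
    case a: True
    have "(\<exists>k. ?F (w @ [a]) = alternating_word x y k)
      \<longleftrightarrow> (\<exists>k. ?F w = alternating_word x y k \<and> a = (if even k then x else y))"
    proof
      assume "\<exists>k. ?F (w @ [a]) = alternating_word x y k"
      then obtain k where k: "?F w @ [a] = alternating_word x y k" using a by auto
      then obtain j where "k = Suc j" by (cases k) (auto simp: alternating_word_def)
      then show "\<exists>k. ?F w = alternating_word x y k \<and> a = (if even k then x else y)"
        using k by (auto simp: alternating_word_Suc)
    next
      assume "\<exists>k. ?F w = alternating_word x y k \<and> a = (if even k then x else y)"
      then obtain k where "?F w = alternating_word x y k" "a = (if even k then x else y)" by blast
      then have "?F (w @ [a]) = alternating_word x y (Suc k)" using a by (simp add: alternating_word_Suc)
      then show "\<exists>k. ?F (w @ [a]) = alternating_word x y k" ..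
    qed
    also have "\<dots> \<longleftrightarrow> (\<exists>k. ?F w = alternating_word x y k) \<and> ?P (w @ [a])"
    proof -
      have "a = (if even k then x else y) \<longleftrightarrow> ?P (w @ [a])" if "?F w = alternating_word x y k" for k
        using counts[OF that] a assms by (cases "even k") (auto elim!: evenE oddE)
      then show ?thesis by blast
    qed
    finally show ?thesis unfolding takes snoc.IH .
  qed
qed

section \<open>The first-occurrence order\<close>

definition first_pos :: "'a list \<Rightarrow> 'a \<Rightarrow> nat" where
  "first_pos w x = length (takeWhile (\<lambda>z. z \<noteq> x) w)"

lemma first_pos_less: "x \<in> set w \<Longrightarrow> first_pos w x < length w"
  unfolding first_pos_def by (induction w) auto

lemma nth_first_pos: "x \<in> set w \<Longrightarrow> w ! first_pos w x = x"
  using nth_length_takeWhile[of "\<lambda>z. z \<noteq> x" w] first_pos_less[of x w] by (simp add: first_pos_def)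

lemma first_pos_inj: "inj_on (first_pos w) (set w)"
  by (rule inj_onI) (metis nth_first_pos)

lemma count_take_first_pos:
  assumes "x \<in> set w" "y \<in> set w" "first_pos w x < first_pos w y"
  shows "count_list (take (Suc (first_pos w x)) w) x > 0" "count_list (take (Suc (first_pos w x)) w) y = 0"
proof -
  have "x \<in> set (take (Suc (first_pos w x)) w)"
    using assms by (metis first_pos_less in_set_conv_nth length_take lessI min.absorb4 nth_first_pos
        nth_take Suc_leI min.absorb2)
  then show "count_list (take (Suc (first_pos w x)) w) x > 0"
    by (metis count_list_0_iff gr0I)
  have "y \<notin> set (take (first_pos w y) w)"
    unfolding first_pos_def takeWhile_eq_take[symmetric] using set_takeWhileD by fast
  moreover have "set (take (Suc (first_pos w x)) w) \<subseteq> set (take (first_pos w y) w)"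
    using assms by (intro set_take_subset_set_take) simp
  ultimately show "count_list (take (Suc (first_pos w x)) w) y = 0"
    by (metis count_list_0_iff subsetD)
qed

text \<open>\<open>alternate\<close> lets either letter start. In the prefix ending with the first
  \<open>x\<close> the count of \<open>y\<close> is still 0, which rules out the band in which
  \<open>y\<close> leads.\<close>

lemma alternate_iff_counts:
  assumes "x \<in> set w" "y \<in> set w" "first_pos w x < first_pos w y"
  shows "alternate x y w \<longleftrightarrow> (\<forall>i. count_list (take i w) y \<le> count_list (take i w) x \<and>
         count_list (take i w) x \<le> count_list (take i w) y + 1)" (is "_ = (\<forall>i. ?P i)")
proof -
  have ne: "x \<noteq> y" using assms(3) by auto
  have "filter (\<lambda>z. z = x \<or> z = y) w = filter (\<lambda>z. z = y \<or> z = x) w"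
    by (rule filter_cong) auto
  then have "alternate x y w \<longleftrightarrow> (\<forall>i. ?P i) \<or> (\<forall>i. count_list (take i w) x \<le> count_list (take i w) y \<and>
         count_list (take i w) y \<le> count_list (take i w) x + 1)"
    unfolding alternate_def ex_disj_distrib
    using alternating_word_iff_counts[OF ne, of w] alternating_word_iff_counts[OF ne[symmetric], of w] by simp
  then show ?thesis
    using count_take_first_pos[OF assms] by (metis leD)
qed

text \<open>Only this consequence of semi-transitivity of the first-occurrence order is needed.\<close>

lemma alternate_shortcut:
  assumes "set w = V" "a \<in> V" "b \<in> V" "c \<in> V" "d \<in> V"
    and "first_pos w a < first_pos w b" "first_pos w b < first_pos w c" "first_pos w c < first_pos w d"
    and "alternate a b w" "alternate b c w" "alternate c d w" "alternate a d w"
  shows "alternate a c w"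
proof -
  let ?n = "\<lambda>z i. count_list (take i w) z"
  have "first_pos w a < first_pos w c" "first_pos w a < first_pos w d" using assms by auto
  \<comment> \<open>On every prefix the counts satisfy \<open>c \<le> b \<le> a\<close> by the pairs
    \<open>bc\<close>, \<open>ab\<close>, and \<open>a \<le> d + 1 \<le> c + 1\<close> by the pairs
    \<open>ad\<close>, \<open>cd\<close>.\<close>
  then show ?thesis
    using assms by (simp add: alternate_iff_counts) (meson le_trans Suc_le_mono)
qed

definition graph_of_pairs :: "nat \<Rightarrow> (nat \<times> nat) set \<Rightarrow> nat graph" where
  "graph_of_pairs n A = ({1..n}, (\<lambda>(u, v). {u, v}) ` A)"

text \<open>Relabelling each vertex by its rank in the first-occurrence order turns that order into
  the order of the numbers, so \<open>alternate_shortcut\<close> becomes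
  \<open>shortcut_free\<close>.\<close>

lemma word_representable_iso_shortcut_free:
  assumes "G \<in> word_representable_graphs n"
  obtains A where "A \<subseteq> fwd_pairs {1..n}" "shortcut_free A" "graph_iso G (graph_of_pairs n A)"
proof -
  let ?V = "{1..n}"
  obtain E where G: "G = (?V, E)" and E: "E \<subseteq> {e. e \<subseteq> ?V \<and> card e = 2}" and rep: "word_representable (?V, E)"
    using assms unfolding word_representable_graphs_def simple_graph_def by blast
  obtain w where "set w = ?V \<and> (\<forall>x\<in>?V. \<forall>y\<in>?V. x \<noteq> y \<longrightarrow> (alternate x y w \<longleftrightarrow> {x, y} \<in> E))"
    using rep unfolding word_representable_def prod.case by (rule exE)
  note w = conjunct1[OF this] and alt = conjunct2[OF this, rule_format]
  define h where "h = first_pos w"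
  have h_inj: "x = y" if "x \<in> ?V" "y \<in> ?V" "h x = h y" for x y
    using inj_onD[OF first_pos_inj[of w]] that unfolding h_def w by blast
  \<comment> \<open>The rank by first occurrence; a vertex counts itself, so ranks start at 1 and
    \<open>f\<close> permutes the vertex set.\<close>
  define f where "f x = card {y \<in> ?V. h y \<le> h x}" for x
  have f_less: "f x < f y" if "y \<in> ?V" "h x < h y" for x y
    unfolding f_def
  proof (intro psubset_card_mono psubsetI)
    have "y \<in> {z \<in> ?V. h z \<le> h y}" "y \<notin> {z \<in> ?V. h z \<le> h x}" using that by auto
    then show "{z \<in> ?V. h z \<le> h x} \<noteq> {z \<in> ?V. h z \<le> h y}" by blast
    show "{z \<in> ?V. h z \<le> h x} \<subseteq> {z \<in> ?V. h z \<le> h y}" using that(2) by auto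
  qed simp
  have f_less_iff: "f x < f y \<longleftrightarrow> h x < h y" if "x \<in> ?V" "y \<in> ?V" for x y
    using f_less[of x y] f_less[of y x] h_inj[of x y] that by (metis less_asym' linorder_neqE_nat)
  have f_range: "f x \<in> ?V" if "x \<in> ?V" for x
  proof -
    have "x \<in> {y \<in> ?V. h y \<le> h x}" using that by simp
    then have "f x > 0" unfolding f_def by (subst card_gt_0_iff) auto
    moreover have "f x \<le> card ?V" unfolding f_def by (rule card_mono) auto
    ultimately show ?thesis by simp
  qed
  have f_inj: "inj_on f ?V"
    by (rule inj_onI) (metis f_less h_inj less_irrefl linorder_neqE_nat)
  have bij: "bij_betw f ?V ?V"
  proof -
    have "f ` ?V \<subseteq> ?V" by (rule image_subsetI[OF f_range])
    then have "f ` ?V = ?V" using f_inj by (intro endo_inj_surj) auto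
    then show ?thesis using f_inj by (simp only: bij_betw_def)
  qed
  define A where "A = {(u, v). \<exists>x y. x \<in> ?V \<and> y \<in> ?V \<and> {x, y} \<in> E \<and> h x < h y \<and> u = f x \<and> v = f y}"
  have A_mem: "(u, v) \<in> A \<longleftrightarrow> (\<exists>x y. x \<in> ?V \<and> y \<in> ?V \<and> {x, y} \<in> E \<and> h x < h y \<and> u = f x \<and> v = f y)" for u v
    by (simp only: A_def mem_Collect_eq prod.case)
  have A_iff: "(f x, f y) \<in> A \<longleftrightarrow> {x, y} \<in> E \<and> h x < h y" if "x \<in> ?V" "y \<in> ?V" for x y
  proof
    assume "(f x, f y) \<in> A"
    then obtain x' y' where *: "x' \<in> ?V" "y' \<in> ?V" "{x', y'} \<in> E" "h x' < h y'" "f x = f x'" "f y = f y'"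
      unfolding A_mem by (elim exE conjE) (rule that)
    then have "x = x'" "y = y'" using inj_onD[OF f_inj *(5) that(1) *(1)] inj_onD[OF f_inj *(6) that(2) *(2)] by simp_all
    then show "{x, y} \<in> E \<and> h x < h y" using * by simp
  next
    assume "{x, y} \<in> E \<and> h x < h y"
    then show "(f x, f y) \<in> A" unfolding A_mem using that by blast
  qed
  have A_elim: "\<exists>x y. x \<in> ?V \<and> y \<in> ?V \<and> u = f x \<and> v = f y" if "(u, v) \<in> A" for u v
    using that unfolding A_mem by blast
  have sub: "A \<subseteq> fwd_pairs ?V"
  proof
    fix e assume e: "e \<in> A"
    obtain u v where uv: "e = (u, v)" by (cases e)
    from e obtain x y where "x \<in> ?V" "y \<in> ?V" "h x < h y" "u = f x" "v = f y"
      unfolding uv A_mem by (elim exE conjE) (rule that)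
    then show "e \<in> fwd_pairs ?V" using f_range f_less unfolding uv fwd_pairs_def by simp
  qed
  have "shortcut_free A" unfolding shortcut_free_def
  proof (intro allI impI)
    fix a' b' c' d' assume *: "(a', b') \<in> A" "(b', c') \<in> A" "(c', d') \<in> A" "(a', d') \<in> A"
    obtain a b c d where V: "a \<in> ?V" "b \<in> ?V" "c \<in> ?V" "d \<in> ?V" "a' = f a" "b' = f b" "c' = f c" "d' = f d"
      using A_elim[OF *(1)] A_elim[OF *(3)] by blast
    have e: "{a, b} \<in> E" "{b, c} \<in> E" "{c, d} \<in> E" "{a, d} \<in> E"
      and less: "h a < h b" "h b < h c" "h c < h d"
      using * A_iff[OF V(1,2)] A_iff[OF V(2,3)] A_iff[OF V(3,4)] A_iff[OF V(1,4)] unfolding V(5-8) by blast+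
    have ne: "a \<noteq> b" "b \<noteq> c" "c \<noteq> d" "a \<noteq> d" "a \<noteq> c" using less by auto
    have "alternate a c w"
      using alternate_shortcut[OF w V(1-4) less[unfolded h_def]] e
        alt[OF V(1,2) ne(1)] alt[OF V(2,3) ne(2)] alt[OF V(3,4) ne(3)] alt[OF V(1,4) ne(4)] by blast
    moreover have "h a < h c" using less by simp
    ultimately show "(a', c') \<in> A"
      using alt[OF V(1,3) ne(5)] A_iff[OF V(1,3)] unfolding V(5,7) by blast
  qed
  moreover have "graph_iso G (graph_of_pairs n A)"
    unfolding graph_iso_def G graph_of_pairs_def prod.case
  proof (intro exI[of _ f] conjI ballI bij)
    fix x y assume xy: "x \<in> ?V" "y \<in> ?V"
    have "{f x, f y} \<in> (\<lambda>(u, v). {u, v}) ` A \<longleftrightarrow> (f x, f y) \<in> A \<or> (f y, f x) \<in> A"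
      by (auto simp: image_iff doubleton_eq_iff split: prod.splits)
    also have "\<dots> \<longleftrightarrow> {x, y} \<in> E \<and> h x \<noteq> h y"
      using A_iff[OF xy] A_iff[OF xy(2,1)] insert_commute[of x y "{}"] by auto
    also have "\<dots> \<longleftrightarrow> {x, y} \<in> E"
    proof -
      have "x \<noteq> y" if "{x, y} \<in> E" using that E by auto
      then show ?thesis using h_inj xy by blast
    qed
    finally show "{x, y} \<in> E \<longleftrightarrow> {f x, f y} \<in> (\<lambda>(u, v). {u, v}) ` A" by simp
  qed
  ultimately show ?thesis using that sub by blast
qed

text \<open>Every class consists of the representable graphs isomorphic to
  \<open>graph_of_pairs n A\<close> for some \<open>A\<close>, so the sets \<open>?cl A\<close>
  include all classes; only surjectivity is claimed.\<close>

lemma num_unlabelled_le_shortcut_free: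
  "num_unlabelled_word_representable n \<le> card {A. A \<subseteq> fwd_pairs {1..n} \<and> shortcut_free A}"
proof -
  let ?S = "word_representable_graphs n" and ?F = "{A. A \<subseteq> fwd_pairs {1..n} \<and> shortcut_free A}"
  let ?cl = "\<lambda>A. {G \<in> ?S. graph_iso G (graph_of_pairs n A)}"
  have finF: "finite ?F" using finite_fwd_pairs[of "{1..n}"] by simp
  have "?S // graph_iso_on ?S \<subseteq> ?cl ` ?F"
  proof
    fix C assume "C \<in> ?S // graph_iso_on ?S"
    then obtain G where G: "G \<in> ?S" "C = {H \<in> ?S. graph_iso G H}"
      by (auto simp: quotient_def graph_iso_on_def)
    obtain A where A: "A \<in> ?F" "graph_iso G (graph_of_pairs n A)"
      using word_representable_iso_shortcut_free[OF G(1)] by blast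
    have "graph_iso G H \<longleftrightarrow> graph_iso H (graph_of_pairs n A)" for H :: "nat graph"
      using graph_iso_trans[OF graph_iso_sym[of G H] A(2)] graph_iso_trans[OF A(2) graph_iso_sym[of H]] by iprover
    then have "C = ?cl A" unfolding G(2) by simp
    then show "C \<in> ?cl ` ?F" using A(1) by blast
  qed
  then show ?thesis unfolding num_unlabelled_word_representable_def by (rule surj_card_le[OF finF])
qed

section \<open>Three-partite graphs\<close>

abbreviation pair_filter :: "'a \<Rightarrow> 'a \<Rightarrow> 'a list \<Rightarrow> 'a list" where
  "pair_filter x y \<equiv> filter (\<lambda>z. z = x \<or> z = y)"

lemma alternate_commute: "alternate x y w \<longleftrightarrow> alternate y x w"
proof -
  have "pair_filter x y w = pair_filter y x w" by (rule filter_cong) auto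
  then show ?thesis unfolding alternate_def by auto
qed

lemma alternate_concat:
  assumes "\<And>u. u \<in> set us \<Longrightarrow> pair_filter x y u = [x, y, x, y]"
  shows "alternate x y (concat us)"
proof -
  have "pair_filter x y (concat us) = alternating_word x y (4 * length us)"
    using assms
  proof (induction us rule: rev_induct)
    case Nil
    then show ?case by (simp add: alternating_word_def)
  next
    case (snoc u us)
    have "alternating_word x y (4 + k) = alternating_word x y k @ [x, y, x, y]" if "even k" for k
    proof -
      have "4 + k = Suc (Suc (Suc (Suc k)))" by simp
      then show ?thesis using that by (simp only: alternating_word_Suc) simp
    qed
    then show ?case using snoc by simp
  qed
  then show ?thesis unfolding alternate_def by blast
qed

lemma not_alternate_repetition:
  assumes "x \<noteq> y" and "pair_filter x y u = p @ [z, z] @ q"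
  shows "\<not> alternate x y (w1 @ u @ w3)"
proof -
  have no_rep: "a @ [z, z] @ b \<noteq> alternating_word s t k" if "s \<noteq> t" for a b s t k
  proof
    assume eq: "a @ [z, z] @ b = alternating_word s t k"
    from arg_cong[OF eq, of length] have len: "length a + 2 + length b = k"
      by (simp add: alternating_word_def)
    from arg_cong[OF eq, of "\<lambda>v. v ! length a"] arg_cong[OF eq, of "\<lambda>v. v ! Suc (length a)"]
    show False using len that by (auto simp: alternating_word_def nth_append split: if_splits)
  qed
  have "pair_filter x y (w1 @ u @ w3) = (pair_filter x y w1 @ p) @ [z, z] @ (q @ pair_filter x y w3)"
    using assms(2) by simp
  then show ?thesis
    unfolding alternate_def using no_rep[OF assms(1)] no_rep[OF assms(1)[symmetric]] by (simp only:) blast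
qed

lemma not_alternate_concat:
  assumes "x \<noteq> y" "u \<in> set us" "pair_filter x y u = p @ [z, z] @ q"
  shows "\<not> alternate x y (concat us)"
proof -
  obtain us1 us2 where "us = us1 @ u # us2" using assms(2) by (meson split_list)
  then show ?thesis using not_alternate_repetition[OF assms(1,3), of "concat us1" "concat us2"] by simp
qed

lemma pair_filter_sorted_list_of_set:
  fixes x y :: "'a::linorder"
  assumes "finite S" "x \<noteq> y"
  shows "pair_filter x y (sorted_list_of_set S) =
    (if x \<in> S then (if y \<in> S then (if x < y then [x, y] else [y, x]) else [x])
     else if y \<in> S then [y] else [])"
  by (rule sorted_distinct_set_unique) (use assms in \<open>auto simp: sorted_wrt_filter\<close>)

text \<open>For an orientation \<open>A \<rightarrow> B \<rightarrow> C\<close> of the edges every block below restricts to \<open>xyxy\<close> on each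
  edge \<open>x \<rightarrow> y\<close>, and for each non-edge some block restricts to a word with a repeated letter.\<close>

lemma tripartite_word_representable:
  fixes A B C :: "'a::linorder set"
  assumes fin: "finite A" "finite B" "finite C"
    and disj: "A \<inter> B = {}" "A \<inter> C = {}" "B \<inter> C = {}"
    and E: "\<And>x y. x \<in> A \<and> y \<in> A \<or> x \<in> B \<and> y \<in> B \<or> x \<in> C \<and> y \<in> C \<Longrightarrow> {x, y} \<notin> E"
  shows "word_representable (A \<union> B \<union> C, E)"
proof -
  let ?l = "sorted_list_of_set"
  define N where "N x = {y. {x, y} \<in> E}" for x
  \<comment> \<open>Each block contains every letter twice. Reversing the second copies makes pairs
    inside one part read \<open>xyyx\<close>, while pairs from different parts still read
    \<open>xyxy\<close>.\<close>
  define R where "R = ?l A @ ?l B @ ?l C @ rev (?l A) @ rev (?l B) @ rev (?l C)"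
  \<comment> \<open>The second \<open>a\<close> is delayed past its non-neighbours \<open>y\<close>
    in \<open>B\<close>, which then read \<open>ayya\<close> with it; all other pairs from different
    parts keep \<open>xyxy\<close>. \<open>BC\<close> is the same device one part further.\<close>
  define AB where "AB a = ?l A @ ?l B @ ?l C @ ?l (A - {a}) @ ?l (B - N a) @ [a] @ ?l (B \<inter> N a) @ ?l C" for a
  define BC where "BC b = ?l A @ ?l B @ ?l C @ ?l A @ ?l (B - {b}) @ ?l (C - N b) @ [b] @ ?l (C \<inter> N b)" for b
  \<comment> \<open>Delaying \<open>a\<close> past a member of \<open>C\<close> would disturb its
    pairs with \<open>B\<close>, which precedes \<open>C\<close>. Instead the second
    \<open>a\<close> is advanced ahead of its non-neighbours \<open>y\<close> in \<open>C\<close>,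
    giving \<open>aayy\<close>.\<close>
  define AC where "AC a = ?l A @ ?l B @ ?l (C \<inter> N a) @ [a] @ ?l (C - N a) @ ?l (A - {a}) @ ?l B @ ?l C" for a
  define us where "us = R # map AB (?l A) @ map BC (?l B) @ map AC (?l A)"
  have in_us: "u \<in> set us \<longleftrightarrow> u = R \<or> (\<exists>a\<in>A. u = AB a) \<or> (\<exists>b\<in>B. u = BC b) \<or> (\<exists>a\<in>A. u = AC a)" for u
    using fin by (auto simp: us_def)
  have set_us: "set (concat us) = A \<union> B \<union> C"
  proof
    have "set u \<subseteq> A \<union> B \<union> C" if "u \<in> set us" for u
      using that fin unfolding in_us by (auto simp: R_def AB_def BC_def AC_def)
    then show "set (concat us) \<subseteq> A \<union> B \<union> C" by auto
    have "set R = A \<union> B \<union> C" using fin by (auto simp: R_def)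
    then show "A \<union> B \<union> C \<subseteq> set (concat us)" by (simp add: us_def)
  qed
  note filt = pair_filter_sorted_list_of_set fin rev_filter[symmetric]
  have notin: "z \<in> A \<Longrightarrow> z \<notin> B" "z \<in> A \<Longrightarrow> z \<notin> C" "z \<in> B \<Longrightarrow> z \<notin> A" "z \<in> B \<Longrightarrow> z \<notin> C"
    "z \<in> C \<Longrightarrow> z \<notin> A" "z \<in> C \<Longrightarrow> z \<notin> B" for z
    using disj by auto
  have AB: "alternate x y (concat us) \<longleftrightarrow> {x, y} \<in> E" if x: "x \<in> A" and y: "y \<in> B" for x y
  proof -
    have ne: "x \<noteq> y" using x y disj by auto
    note s = filt ne ne[symmetric] notin(1,2)[OF x] notin(3,4)[OF y] x y
    show ?thesis
    proof (cases "{x, y} \<in> E")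
      case True
      then have N: "y \<in> N x" by (simp add: N_def)
      have "pair_filter x y u = [x, y, x, y]" if "u \<in> set us" for u
        using that unfolding in_us
      proof (elim disjE bexE)
        assume "u = R"
        then show ?thesis by (simp add: R_def s)
      next
        fix a assume "a \<in> A" "u = AB a"
        then show ?thesis using N by (cases "a = x"; cases "y \<in> N a") (auto simp: AB_def s)
      next
        fix b assume "b \<in> B" "u = BC b"
        then show ?thesis by (cases "b = y") (auto simp: BC_def s)
      next
        fix a assume "a \<in> A" "u = AC a"
        then show ?thesis by (cases "a = x") (auto simp: AC_def s)
      qed
      then have "alternate x y (concat us)" by (rule alternate_concat)
      then show ?thesis using True by simp
    next
      case False
      then have N: "y \<notin> N x" by (simp add: N_def)
      have "AB x \<in> set us" unfolding in_us using x by blast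
      moreover have "pair_filter x y (AB x) = [x] @ [y, y] @ [x]" using N by (simp add: AB_def s)
      ultimately have "\<not> alternate x y (concat us)" by (rule not_alternate_concat[OF ne])
      then show ?thesis using False by simp
    qed
  qed
  have BC: "alternate x y (concat us) \<longleftrightarrow> {x, y} \<in> E" if x: "x \<in> B" and y: "y \<in> C" for x y
  proof -
    have ne: "x \<noteq> y" using x y disj by auto
    note s = filt ne ne[symmetric] notin(3,4)[OF x] notin(5,6)[OF y] x y
    show ?thesis
    proof (cases "{x, y} \<in> E")
      case True
      then have N: "y \<in> N x" by (simp add: N_def)
      have "pair_filter x y u = [x, y, x, y]" if "u \<in> set us" for u
        using that unfolding in_us
      proof (elim disjE bexE)
        assume "u = R"
        then show ?thesis by (simp add: R_def s)
      next
        fix a assume a: "a \<in> A" "u = AB a"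
        then have "a \<noteq> x" "a \<noteq> y" using disj x y by auto
        then show ?thesis using a by (cases "x \<in> N a") (auto simp: AB_def s)
      next
        fix b assume b: "b \<in> B" "u = BC b"
        then have "b \<noteq> y" using disj y by auto
        then show ?thesis using b N by (cases "b = x"; cases "y \<in> N b") (auto simp: BC_def s)
      next
        fix a assume a: "a \<in> A" "u = AC a"
        then have "a \<noteq> x" "a \<noteq> y" using disj x y by auto
        then show ?thesis using a by (cases "y \<in> N a") (auto simp: AC_def s)
      qed
      then have "alternate x y (concat us)" by (rule alternate_concat)
      then show ?thesis using True by simp
    next
      case False
      then have N: "y \<notin> N x" by (simp add: N_def)
      have "BC x \<in> set us" unfolding in_us using x by blast
      moreover have "pair_filter x y (BC x) = [x] @ [y, y] @ [x]" using N by (simp add: BC_def s)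
      ultimately have "\<not> alternate x y (concat us)" by (rule not_alternate_concat[OF ne])
      then show ?thesis using False by simp
    qed
  qed
  have AC: "alternate x y (concat us) \<longleftrightarrow> {x, y} \<in> E" if x: "x \<in> A" and y: "y \<in> C" for x y
  proof -
    have ne: "x \<noteq> y" using x y disj by auto
    note s = filt ne ne[symmetric] notin(1,2)[OF x] notin(5,6)[OF y] x y
    show ?thesis
    proof (cases "{x, y} \<in> E")
      case True
      then have N: "y \<in> N x" by (simp add: N_def)
      have "pair_filter x y u = [x, y, x, y]" if "u \<in> set us" for u
        using that unfolding in_us
      proof (elim disjE bexE)
        assume "u = R"
        then show ?thesis by (simp add: R_def s)
      next
        fix a assume a: "a \<in> A" "u = AB a"
        then have "a \<noteq> y" using disj y by auto
        then show ?thesis using a by (cases "a = x") (auto simp: AB_def s)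
      next
        fix b assume b: "b \<in> B" "u = BC b"
        then have "b \<noteq> x" "b \<noteq> y" using disj x y by auto
        then show ?thesis using b by (cases "y \<in> N b") (auto simp: BC_def s)
      next
        fix a assume a: "a \<in> A" "u = AC a"
        then have "a \<noteq> y" using disj y by auto
        then show ?thesis using a N by (cases "a = x"; cases "y \<in> N a") (auto simp: AC_def s)
      qed
      then have "alternate x y (concat us)" by (rule alternate_concat)
      then show ?thesis using True by simp
    next
      case False
      then have N: "y \<notin> N x" by (simp add: N_def)
      have "AC x \<in> set us" unfolding in_us using x by blast
      moreover have "pair_filter x y (AC x) = [] @ [x, x] @ [y, y]" using N by (simp add: AC_def s)
      ultimately have "\<not> alternate x y (concat us)" by (rule not_alternate_concat[OF ne])
      then show ?thesis using False by simp
    qed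
  qed
  have same: "alternate x y (concat us) \<longleftrightarrow> {x, y} \<in> E"
    if xy: "x \<in> A \<and> y \<in> A \<or> x \<in> B \<and> y \<in> B \<or> x \<in> C \<and> y \<in> C" and ne: "x \<noteq> y" for x y
  proof -
    have "pair_filter x y R = (if x < y then [x] @ [y, y] @ [x] else [y] @ [x, x] @ [y])"
      using xy
    proof (elim disjE conjE)
      assume "x \<in> A" "y \<in> A"
      then show ?thesis using notin(1,2)[of x] notin(1,2)[of y] by (simp add: R_def filt ne)
    next
      assume "x \<in> B" "y \<in> B"
      then show ?thesis using notin(3,4)[of x] notin(3,4)[of y] by (simp add: R_def filt ne)
    next
      assume "x \<in> C" "y \<in> C"
      then show ?thesis using notin(5,6)[of x] notin(5,6)[of y] by (simp add: R_def filt ne)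
    qed
    then obtain p z q where "pair_filter x y R = p @ [z, z] @ q" by metis
    moreover have "R \<in> set us" unfolding in_us by blast
    ultimately have "\<not> alternate x y (concat us)" by (rule not_alternate_concat[OF ne, rotated])
    then show ?thesis using E[OF xy] by simp
  qed
  have "alternate x y (concat us) \<longleftrightarrow> {x, y} \<in> E"
    if "x \<in> A \<union> B \<union> C" "y \<in> A \<union> B \<union> C" "x \<noteq> y" for x y
    using that AB[of x y] AB[of y x] BC[of x y] BC[of y x] AC[of x y] AC[of y x] same[of x y]
    unfolding alternate_commute[of y x] insert_commute[of y x "{}"] by blast
  then show ?thesis
    unfolding word_representable_def prod.case using set_us by blast
qed

section \<open>From labelled to unlabelled counts\<close>

lemma inj_on_graph_of_pairs: "inj_on (graph_of_pairs n) (Pow (fwd_pairs V))"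
proof -
  have "inj_on (\<lambda>(u, v). {u, v}) (fwd_pairs V)"
    by (auto simp: inj_on_def fwd_pairs_def doubleton_eq_iff)
  then have "inj_on ((`) (\<lambda>(u, v). {u, v})) (Pow (fwd_pairs V))" by (rule inj_on_image_Pow)
  then show ?thesis by (auto simp: inj_on_def graph_of_pairs_def)
qed

text \<open>Three fixed intervals of sizes \<open>m\<close>, \<open>m\<close> and
  \<open>n - 2 * m\<close> with \<open>m = n div 3\<close> have at least
  \<open>3 * m\<^sup>2\<close> pairs between them, and every set of such pairs is a different
  representable labelled graph.\<close>

lemma card_word_representable_graphs_ge:
  "2 ^ (3 * (n div 3)\<^sup>2) \<le> card (word_representable_graphs n)"
proof -
  define m where "m = n div 3"
  have m: "3 * m \<le> n" by (simp add: m_def)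
  let ?A = "{1..m}" and ?B = "{m+1..2*m}" and ?C = "{2*m+1..n}"
  define P where "P = ?A \<times> ?B \<union> ?A \<times> ?C \<union> ?B \<times> ?C"
  have P_fwd: "P \<subseteq> fwd_pairs {1..n}" using m by (auto simp: P_def fwd_pairs_def)
  have finP: "finite P" by (simp add: P_def)
  have "card P = m * m + m * (n - 2 * m) + m * (n - 2 * m)"
  proof -
    have "(?A \<times> ?B \<union> ?A \<times> ?C) \<inter> ?B \<times> ?C = {}" "?A \<times> ?B \<inter> ?A \<times> ?C = {}" by auto
    then show ?thesis unfolding P_def by (simp add: card_Un_disjoint card_cartesian_product)
  qed
  moreover have "m * m \<le> m * (n - 2 * m)" using m by (intro mult_le_mono2) simp
  ultimately have card_P: "3 * m\<^sup>2 \<le> card P" unfolding power2_eq_square by linarith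
  have "graph_of_pairs n D \<in> word_representable_graphs n" if "D \<subseteq> P" for D
  proof -
    let ?E = "(\<lambda>(u, v). {u, v}) ` D"
    have V: "?A \<union> ?B \<union> ?C = {1..n}" using m by auto
    have "{x, y} \<notin> ?E" if "x \<in> ?A \<and> y \<in> ?A \<or> x \<in> ?B \<and> y \<in> ?B \<or> x \<in> ?C \<and> y \<in> ?C" for x y
      using that \<open>D \<subseteq> P\<close> by (auto simp: P_def doubleton_eq_iff)
    then have "word_representable (?A \<union> ?B \<union> ?C, ?E)"
      by (intro tripartite_word_representable) auto
    moreover have "simple_graph ({1..n}, ?E)"
    proof -
      have "{u, v} \<subseteq> {1..n} \<and> card {u, v} = 2" if "(u, v) \<in> D" for u v
        using that \<open>D \<subseteq> P\<close> P_fwd by (force simp: fwd_pairs_def)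
      then show ?thesis unfolding simple_graph_def by auto
    qed
    ultimately show ?thesis
      unfolding V by (simp add: word_representable_graphs_def graph_of_pairs_def)
  qed
  then have "graph_of_pairs n ` Pow P \<subseteq> word_representable_graphs n" by auto
  moreover have "finite (word_representable_graphs n)"
    by (rule finite_subset[of _ "{{1..n}} \<times> Pow (Pow {1..n})"])
      (auto simp: word_representable_graphs_def simple_graph_def)
  ultimately have "card (graph_of_pairs n ` Pow P) \<le> card (word_representable_graphs n)"
    by (intro card_mono)
  moreover have "card (graph_of_pairs n ` Pow P) = 2 ^ card P"
    using card_image[OF inj_on_subset[OF inj_on_graph_of_pairs Pow_mono[OF P_fwd]]] finP by (simp add: card_Pow)
  moreover have "(2::nat) ^ (3 * m\<^sup>2) \<le> 2 ^ card P" using card_P by (intro power_increasing) auto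
  ultimately show ?thesis unfolding m_def by linarith
qed

text \<open>A class lies among the images of one member under self-maps of \<open>{1..n}\<close>.
  Counting all \<open>n ^ n\<close> maps instead of the permutations still costs only n log n in the
  exponent.\<close>

lemma card_word_representable_graphs_le:
  "card (word_representable_graphs n) \<le> num_unlabelled_word_representable n * n ^ n"
proof -
  let ?S = "word_representable_graphs n" and ?V = "{1..n}"
  let ?Q = "?S // graph_iso_on ?S"
  have finS: "finite ?S"
    by (rule finite_subset[of _ "{?V} \<times> Pow (Pow ?V)"])
      (auto simp: word_representable_graphs_def simple_graph_def)
  have finQ: "finite ?Q" by (rule finite_quotient[OF finS]) (auto simp: graph_iso_on_def)
  have "card C \<le> n ^ n" if C: "C \<in> ?Q" for C
  proof -
    obtain G where G: "G \<in> ?S" "C = {H \<in> ?S. graph_iso G H}"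
      using C by (auto simp: quotient_def graph_iso_on_def)
    obtain E where E: "G = (?V, E)" "E \<subseteq> {e. e \<subseteq> ?V \<and> card e = 2}"
      using G(1) by (auto simp: word_representable_graphs_def simple_graph_def)
    let ?im = "\<lambda>f. (?V, (`) f ` E)"
    have "C \<subseteq> ?im ` (?V \<rightarrow>\<^sub>E ?V)"
    proof
      fix H assume "H \<in> C"
      then obtain E' f where H: "H = (?V, E')" "E' \<subseteq> {e. e \<subseteq> ?V \<and> card e = 2}"
        and f: "bij_betw f ?V ?V" "\<forall>x\<in>?V. \<forall>y\<in>?V. {x, y} \<in> E \<longleftrightarrow> {f x, f y} \<in> E'"
        unfolding G(2) E(1) by (auto simp: word_representable_graphs_def simple_graph_def graph_iso_def)
      define g where "g = restrict f ?V"
      have g: "g \<in> ?V \<rightarrow>\<^sub>E ?V" using f(1) by (auto simp: g_def bij_betw_def)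
      have "E' = (`) g ` E"
      proof (intro equalityI subsetI)
        fix e assume e: "e \<in> E'"
        then obtain u v where uv: "e = {u, v}" "u \<in> ?V" "v \<in> ?V"
          using H(2) by (auto simp: card_2_iff)
        have "u \<in> f ` ?V" "v \<in> f ` ?V" using uv bij_betw_imp_surj_on[OF f(1)] by simp_all
        then obtain x y where xy: "x \<in> ?V" "y \<in> ?V" "u = f x" "v = f y" by (elim imageE) (rule that)
        then have "{x, y} \<in> E" using f(2)[rule_format, OF xy(1,2)] e uv(1) by simp
        moreover have "g ` {x, y} = e" using xy uv(1) by (simp add: g_def)
        ultimately show "e \<in> (`) g ` E" by blast
      next
        fix e assume "e \<in> (`) g ` E"
        then obtain d where d: "d \<in> E" "e = g ` d" by blast
        then obtain x y where xy: "d = {x, y}" "x \<in> ?V" "y \<in> ?V"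
          using E(2) by (auto simp: card_2_iff)
        then have "e = {f x, f y}" using d by (simp add: g_def)
        then show "e \<in> E'" using f(2)[rule_format, OF xy(2,3)] d(1) xy(1) by simp
      qed
      then show "H \<in> ?im ` (?V \<rightarrow>\<^sub>E ?V)" using g H(1) by blast
    qed
    then have "card C \<le> card (?V \<rightarrow>\<^sub>E ?V)" by (intro surj_card_le) (auto intro: finite_PiE)
    then show ?thesis by (simp add: card_funcsetE)
  qed
  then have "(\<Sum>C\<in>?Q. card C) \<le> (\<Sum>C\<in>?Q. n ^ n)" by (rule sum_mono)
  moreover have "card (\<Union>C\<in>?Q. C) \<le> (\<Sum>C\<in>?Q. card C)" by (rule card_UN_le[OF finQ])
  moreover have "(\<Union>C\<in>?Q. C) = ?S" using Union_quotient[OF equiv_graph_iso_on, of ?S] by simp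
  ultimately show ?thesis by (simp add: num_unlabelled_word_representable_def)
qed

section \<open>Asymptotics\<close>

lemma log_num_unlabelled_ge:
  assumes "n \<ge> 1"
  shows "num_unlabelled_word_representable n > 0"
    and "log 2 (num_unlabelled_word_representable n) \<ge> (real n)\<^sup>2 / 3 - 2 * real n - real n * log 2 n"
proof -
  let ?a = "num_unlabelled_word_representable n" and ?m = "n div 3"
  have *: "2 ^ (3 * ?m\<^sup>2) \<le> ?a * n ^ n"
    using card_word_representable_graphs_ge[of n] card_word_representable_graphs_le[of n] by linarith
  have "(0::nat) < 2 ^ (3 * ?m\<^sup>2)" by simp
  then have "0 < ?a * n ^ n" using * by linarith
  then show pos: "?a > 0" by simp
  have "real (2 ^ (3 * ?m\<^sup>2)) \<le> real (?a * n ^ n)" using * by (simp only: of_nat_le_iff)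
  then have "log 2 (2 ^ (3 * ?m\<^sup>2)) \<le> log 2 (real ?a * real n ^ n)"
    using pos assms by (subst log_le_cancel_iff) auto
  then have "real (3 * ?m\<^sup>2) \<le> log 2 ?a + real n * log 2 n"
    using pos assms by (simp add: log_mult log_nat_power)
  moreover have "(real n)\<^sup>2 / 3 - 2 * real n \<le> real (3 * ?m\<^sup>2)"
  \<comment> \<open>The bound comes from squaring \<open>n - 2 \<le> 3 * ?m\<close>, which requires
    a nonnegative left side; hence the separate case 1.\<close>
  proof (cases "n \<ge> 2")
    case True
    have "real n - 2 \<le> 3 * real ?m" by linarith
    then have "(real n - 2)\<^sup>2 \<le> (3 * real ?m)\<^sup>2" using True by (intro power_mono) auto
    then show ?thesis by (simp add: power2_eq_square algebra_simps)
  next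
    case False
    then have "n = 1" using assms by linarith
    then show ?thesis by simp
  qed
  ultimately show "log 2 ?a \<ge> (real n)\<^sup>2 / 3 - 2 * real n - real n * log 2 n" by linarith
qed

lemma eventually_log_num_unlabelled_le:
  fixes c :: real
  assumes c: "c > 0"
  shows "\<forall>\<^sub>F n in sequentially. log 2 (num_unlabelled_word_representable n) \<le> (real n)\<^sup>2 / 3 + c * (real n)\<^sup>2"
proof -
  \<comment> \<open>Order of choice: \<open>x\<close> for the entropy factor, then
    \<open>\<eta>\<close> against \<open>l\<close>, then \<open>K\<close> from \<open>\<eta>\<close>
    and \<open>\<gamma>\<close>. The contributions of \<open>x\<close>, \<open>\<eta>\<close> and
    \<open>\<gamma>\<close> get \<open>c / 8\<close> each and the terms linear in n get
    \<open>c / 2\<close>, in total \<open>7 / 8 * c\<close>.\<close>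
  define x where "x = min 1 (c / 32)"
  have x: "0 < x" "x \<le> 1" "x \<le> c / 32" using c by (auto simp: x_def)
  define l where "l = log 2 (1 / x)"
  have l: "l \<ge> 0" using x by (simp add: l_def)
  \<comment> \<open>\<open>l + 1\<close> keeps the denominator positive when
    \<open>x = 1\<close>.\<close>
  define \<eta> where "\<eta> = c / (16 * (l + 1))"
  define \<gamma> where "\<gamma> = c / 8"
  have \<eta>: "\<eta> > 0" and \<gamma>: "\<gamma> > 0" using c l by (auto simp: \<eta>_def \<gamma>_def)
  have \<eta>l: "2 * \<eta> * l \<le> c / 8"
  proof -
    have "\<eta> * l \<le> \<eta> * (l + 1)" using \<eta> by simp
    also have "\<dots> = c / 16" using l by (simp add: \<eta>_def field_simps)
    finally show ?thesis by simp
  qed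
  \<comment> \<open>The factor 2 stands for the two correction sets. The crude
    \<open>ln 2 \<ge> 1 / 2\<close> gives \<open>log 2 (1 + x) \<le> 2 * x\<close>, whence
    \<open>c / 32\<close> in the choice of \<open>x\<close>.\<close>
  have lx: "2 * log 2 (1 + x) \<le> c / 8"
  proof -
    have "ln (1 + x) \<le> x" using x by (intro ln_add_one_self_le_self) auto
    moreover have "ln (2::real) \<ge> 1 / 2" using ln_le_minus_one[of "1 / 2 :: real"] by (simp add: ln_div)
    then have "x \<le> 2 * x * ln 2" using x mult_left_mono[of "1 / 2" "ln 2" "2 * x"] by simp
    ultimately have "log 2 (1 + x) \<le> 2 * x" by (simp add: log_def divide_le_eq)
    then show ?thesis using x by simp
  qed
  obtain K :: nat where "2 / (\<eta> ^ 5 * \<gamma> / 2000)\<^sup>2 < real K" using reals_Archimedean2 by blast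
  then have K: "real K * (\<eta> ^ 5 * \<gamma> / 2000)\<^sup>2 > 2" using \<eta> \<gamma> by (subst (asm) pos_divide_less_eq) auto
  \<comment> \<open>\<open>2 * K\<close> bits per vertex for its label, plus the constant for
    choosing \<open>L\<close> and \<open>U\<close>, which \<open>n \<ge> 1\<close> lets the linear
    term absorb.\<close>
  define D where "D = 2 * real K + 2 * (4 ^ K * 4 ^ K)"
  have bound: "log 2 (num_unlabelled_word_representable n) \<le> (real n)\<^sup>2 / 3 + c * (real n)\<^sup>2"
    if n: "n \<ge> 1" "real n \<ge> 2 * D / c" for n
  proof -
    let ?a = "num_unlabelled_word_representable n"
    let ?B = "(4 ^ K) ^ n * (2 ^ (4 ^ K * 4 ^ K)) ^ 2
      * (((1 + x) ^ (n * n) * (1 / x) powr (\<eta> * (real n)\<^sup>2)) ^ 2 * 2 powr ((1 / 3 + \<gamma>) * (real n)\<^sup>2))"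
    have "real ?a \<le> ?B"
      using num_unlabelled_le_shortcut_free[of n] card_shortcut_free_le[of "{1..n}", OF _ \<eta> \<gamma> K x(1,2)] by simp
    then have "log 2 ?a \<le> log 2 ?B"
      using log_num_unlabelled_ge(1)[OF n(1)] by (intro log_mono) auto
    also have "\<dots> = real n * (2 * real K) + 2 * (4 ^ K * 4 ^ K)
        + (2 * (real n * real n * log 2 (1 + x) + \<eta> * (real n)\<^sup>2 * l) + (1 / 3 + \<gamma>) * (real n)\<^sup>2)"
    proof -
      have "log 2 (4::real) = 2" using log_pow_cancel[of 2 2] by simp
      then show ?thesis using x by (simp add: log_mult log_nat_power log_powr l_def)
    qed
    also have "\<dots> \<le> real n * D + ((real n)\<^sup>2 * (c / 8) + (real n)\<^sup>2 * (c / 8) + (1 / 3 + \<gamma>) * (real n)\<^sup>2)"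
    proof -
      have "real n * (2 * real K) + 2 * (4 ^ K * 4 ^ K) \<le> real n * D"
        using n(1) mult_right_mono[of 1 "real n" "2 * (4 ^ K * 4 ^ K)"] by (simp add: D_def distrib_left)
      moreover have "(real n)\<^sup>2 * (2 * log 2 (1 + x)) \<le> (real n)\<^sup>2 * (c / 8)"
        "(real n)\<^sup>2 * (2 * \<eta> * l) \<le> (real n)\<^sup>2 * (c / 8)"
        using lx \<eta>l by (intro mult_left_mono; simp)+
      ultimately show ?thesis by (simp add: power2_eq_square algebra_simps)
    qed
    also have "real n * D \<le> real n * (c / 2 * real n)"
      using n c by (intro mult_left_mono) (auto simp: field_simps)
    also have "real n * (c / 2 * real n) + ((real n)\<^sup>2 * (c / 8) + (real n)\<^sup>2 * (c / 8) + (1 / 3 + \<gamma>) * (real n)\<^sup>2)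
      = (real n)\<^sup>2 / 3 + 7 / 8 * c * (real n)\<^sup>2"
      by (simp add: \<gamma>_def power2_eq_square field_simps)
    also have "\<dots> \<le> (real n)\<^sup>2 / 3 + c * (real n)\<^sup>2" using c by (simp add: mult_right_mono)
    finally show ?thesis by simp
  qed
  obtain n0 :: nat where n0: "2 * D / c \<le> real n0" using real_arch_simple by blast
  show ?thesis
    by (rule eventually_sequentiallyI[of "max 1 n0"]) (use n0 in \<open>auto intro!: bound\<close>)
qed

lemma eventually_log_num_unlabelled_ge:
  fixes c :: real
  assumes c: "c > 0"
  shows "\<forall>\<^sub>F n in sequentially. log 2 (num_unlabelled_word_representable n) \<ge> (real n)\<^sup>2 / 3 - c * (real n)\<^sup>2"
proof -
  obtain n0 :: nat where n0: "4 / c \<le> real n0" using real_arch_simple by blast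
  have "((\<lambda>n. ln (real n) / real n) \<longlonglongrightarrow> 0)"
    by (rule filterlim_compose[OF ln_x_over_x_tendsto_0 filterlim_real_sequentially])
  moreover have "c / 2 * ln 2 > 0" using c by simp
  ultimately have "\<forall>\<^sub>F n in sequentially. ln (real n) / real n < c / 2 * ln 2"
    by (rule order_tendstoD(2))
  then show ?thesis
    using eventually_ge_at_top[of "max 1 n0"]
  proof eventually_elim
    case (elim n)
    then have n: "n \<ge> 1" "4 / c \<le> real n" using n0 by auto
    have "log 2 n \<le> c / 2 * real n" using elim(1) n by (simp add: log_def field_simps)
    moreover have "2 \<le> c / 2 * real n" using n c by (simp add: field_simps)
    ultimately have "real n * (2 + log 2 n) \<le> real n * (c * real n)" by (intro mult_left_mono) auto
    then show ?case using log_num_unlabelled_ge(2)[OF n(1)] by (simp add: power2_eq_square algebra_simps)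
  qed
qed

theorem corollary1:
  "\<exists>\<epsilon> :: nat \<Rightarrow> real. \<epsilon> \<in> o(\<lambda>n. real n ^ 2) \<and>
     (\<forall>n\<ge>1. real (num_unlabelled_word_representable n)
              = 2 powr (real n ^ 2 / 3 + \<epsilon> n))"
proof (intro exI conjI allI impI)
  \<comment> \<open>The error is the exact remainder of the logarithm, so the equation holds as soon
    as the count is positive, and all content lies in its size.\<close>
  let ?\<epsilon> = "\<lambda>n. log 2 (num_unlabelled_word_representable n) - (real n)\<^sup>2 / 3"
  show "?\<epsilon> \<in> o(\<lambda>n. real n ^ 2)"
  proof (rule landau_o.smallI)
    fix c :: real assume "c > 0"
    from eventually_log_num_unlabelled_le[OF this] eventually_log_num_unlabelled_ge[OF this]
    show "\<forall>\<^sub>F n in sequentially. norm (?\<epsilon> n) \<le> c * norm (real n ^ 2)"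
      by eventually_elim (auto simp: abs_le_iff)
  qed
  show "real (num_unlabelled_word_representable n) = 2 powr (real n ^ 2 / 3 + ?\<epsilon> n)" if "n \<ge> 1" for n
    using log_num_unlabelled_ge(1)[OF that] by simp
qed

end
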